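(* Let $\alpha\in[2,3]$. The set $$\{f\in L_\alpha[0,1]^2:\dim_{\mathrm B}G_f=\alpha\text{ and }\dim_{\mathrm B}G_{H(f)}=\alpha-1\}$$ is a 1-prevalent subset of $(L_\alpha[0,1]^2,d_{\mathrm{Lip}_\alpha})$.
   Context: For $d\in\{1,2\}$, $C[0,1]^d$ is the real vector space of continuous functions $f:[0,1]^d\to\mathbb{R}$, with sup norm $\|\cdot\|_\infty$. The graph of $f$ is $G_f=\{(\mathbf{x},f(\mathbf{x})):\mathbf{x}\in[0,1]^d\}\subset\mathbb{R}^{d+1}$. For $f\in C[0,1]^2$ the horizon function $H(f)\in C[0,1]$ is $H(f)(x)=\sup_{y\in[0,1]}f(x,y)$. For a bounded set $F$ in Euclidean space, $\underline{\dim}_{\mathrm B}F$ and $\overline{\dim}_{\mathrm B}F$ are the lower and upper limits as $\delta\to0$ of $\log N_\delta(F)/(-\log\delta)$, where $N_\delta(F)$ is the number of cubes of a $\delta$-mesh which intersect $F$; if they agree the common value is $\dim_{\mathrm B}F$. A condition "$\dim_{\mathrm B}F=s$" means that the box dimension exists and equals $s$. $L_\alpha[0,1]^2$ is the space of $f\in C[0,1]^2$ such that $$\mathrm{Lip}_\alpha(f)=\sup_{x,y\in[0,1]^2,\,x\ne y}\frac{|f(x)-f(y)|}{|x-y|^{3-\alpha}}<\infty .$$ It is a complete normed space under $\|f\|_{\mathrm{Lip}_\alpha}=\|f\|_\infty+\mathrm{Lip}_\alpha(f)$, and $d_{\mathrm{Lip}_\alpha}$ is the corresponding metric. Let $X$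 be a completely metrizable topological vector space. A Borel set $F\subseteq X$ is $k$-prevalent if there is a $k$-dimensional subspace $P\subseteq X$ (a probe for $F$) such that $\mathcal{L}_P(X\setminus(F+x))=0$ for all $x\in X$, where $\mathcal{L}_P$ is $k$-dimensional Lebesgue measure on $P$ (via a linear identification $P\cong\mathbb{R}^k$), regarded as a measure on $X$ by $\mathcal{L}_P(A)=\mathcal{L}_P(A\cap P)$. *)

theory Defs
  imports "HOL-Analysis.Analysis" "HOL-Library.Function_Algebras"
begin

section \<open>Box dimension\<close>

definition mesh_cube :: "real \<Rightarrow> ('a::euclidean_space \<Rightarrow> int) \<Rightarrow> 'a set" where
  "mesh_cube \<delta> k =
     {x. \<forall>b\<in>Basis. of_int (k b) * \<delta> \<le> x \<bullet> b \<and> x \<bullet> b \<le> (of_int (k b) + 1) * \<delta>}"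

definition mesh_count :: "real \<Rightarrow> 'a::euclidean_space set \<Rightarrow> nat" where
  "mesh_count \<delta> F = card {Q \<in> range (mesh_cube \<delta>). Q \<inter> F \<noteq> {}}"

definition lower_box_dim :: "'a::euclidean_space set \<Rightarrow> ereal" where
  "lower_box_dim F =
     Liminf (at_right 0) (\<lambda>\<delta>. ereal (ln (real (mesh_count \<delta> F)) / (- ln \<delta>)))"

definition upper_box_dim :: "'a::euclidean_space set \<Rightarrow> ereal" where
  "upper_box_dim F =
     Limsup (at_right 0) (\<lambda>\<delta>. ereal (ln (real (mesh_count \<delta> F)) / (- ln \<delta>)))"

definition has_box_dim :: "'a::euclidean_space set \<Rightarrow> real \<Rightarrow> bool" where
  "has_box_dim F s \<longleftrightarrow> lower_box_dim F = ereal s \<and> upper_box_dim F = ereal s"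

definition graph_on :: "'a set \<Rightarrow> ('a \<Rightarrow> real) \<Rightarrow> ('a \<times> real) set" where
  "graph_on S f = (\<lambda>x. (x, f x)) ` S"


section \<open>Prevalence\<close>

text \<open>Only the carrier \<^term>\<open>topspace T\<close> is the topological vector space \<open>X\<close>; the ambient type
  merely supplies the linear operations.\<close>

locale completely_metrizable_tvs =
  fixes T :: "'a::real_vector topology"
  assumes subspace_carrier: "subspace (topspace T)"
    and continuous_add: "continuous_map (prod_topology T T) T (\<lambda>(x, y). x + y)"
    and continuous_scale: "continuous_map (prod_topology euclideanreal T) T (\<lambda>(c, x). c *\<^sub>R x)"
    and completely_metrizable: "completely_metrizable_space T"
begin

definition borel_algebra :: "'a measure" where
  "borel_algebra = sigma (topspace T) {U. openin T U}"

definition is_basis_of :: "nat \<Rightarrow> (nat \<Rightarrow> 'a) \<Rightarrow> 'a set \<Rightarrow> bool" where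
  "is_basis_of k b P \<longleftrightarrow>
     inj_on b {..<k} \<and> independent (b ` {..<k}) \<and> span (b ` {..<k}) = P"

text \<open>The measure \<open>\<L>\<^sub>P\<close> on \<open>X\<close> for \<open>P\<close> with basis \<open>b 0, \<dots>, b (k - 1)\<close>: Lebesgue measure on
  \<open>\<real>\<^sup>k\<close> pushed forward along the (continuous) linear identification of \<open>\<real>\<^sup>k\<close> with \<open>P\<close>. A change
  of basis only multiplies it by a positive constant. As only Borel sets are measured, Borel
  and complete Lebesgue measure agree here.\<close>

definition probe_measure :: "nat \<Rightarrow> (nat \<Rightarrow> 'a) \<Rightarrow> 'a measure" where
  "probe_measure k b =
     distr (Pi\<^sub>M {..<k} (\<lambda>_. lborel)) borel_algebra (\<lambda>t. \<Sum>i<k. t i *\<^sub>R b i)"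

definition is_probe :: "nat \<Rightarrow> 'a set \<Rightarrow> 'a set \<Rightarrow> bool" where
  "is_probe k P F \<longleftrightarrow>
     subspace P \<and> P \<subseteq> topspace T \<and>
     (\<exists>b. is_basis_of k b P \<and>
        (\<forall>x\<in>topspace T. topspace T - (\<lambda>y. y + x) ` F \<in> null_sets (probe_measure k b)))"

definition prevalent :: "nat \<Rightarrow> 'a set \<Rightarrow> bool" where
  "prevalent k F \<longleftrightarrow> F \<in> sets borel_algebra \<and> (\<exists>P. is_probe k P F)"

end


section \<open>Pointwise vector space structure on functions\<close>

instantiation "fun" :: (type, real_vector) real_vector
begin

definition scaleR_fun :: "real \<Rightarrow> ('a \<Rightarrow> 'b) \<Rightarrow> 'a \<Rightarrow> 'b" where
  "scaleR_fun c f = (\<lambda>x. c *\<^sub>R f x)"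

instance
  by standard (auto simp: scaleR_fun_def fun_eq_iff scaleR_add_left scaleR_add_right)

end

lemma scaleR_fun_apply [simp]: "(c *\<^sub>R f) x = c *\<^sub>R f x"
  by (simp add: scaleR_fun_def)


section \<open>The function spaces\<close>

abbreviation unit_square :: "(real \<times> real) set" where
  "unit_square \<equiv> {0..1} \<times> {0..1}"

text \<open>A continuous function \<open>S \<rightarrow> \<real>\<close> is represented by its extension by zero, so that the
  represented functions form a subspace of the pointwise vector space of all functions.\<close>

definition cont_space :: "'a::topological_space set \<Rightarrow> ('a \<Rightarrow> real) set" where
  "cont_space S = {f. continuous_on S f \<and> (\<forall>x. x \<notin> S \<longrightarrow> f x = 0)}"

definition horizon :: "(real \<times> real \<Rightarrow> real) \<Rightarrow> real \<Rightarrow> real" where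
  "horizon f x = (if x \<in> {0..1} then SUP y\<in>{0..1}. f (x, y) else 0)"

definition sup_norm :: "(real \<times> real \<Rightarrow> real) \<Rightarrow> ennreal" where
  "sup_norm f = (SUP x\<in>unit_square. ennreal \<bar>f x\<bar>)"

definition Lip :: "real \<Rightarrow> (real \<times> real \<Rightarrow> real) \<Rightarrow> ennreal" where
  "Lip \<alpha> f = (SUP (x, y)\<in>{(x, y). x \<in> unit_square \<and> y \<in> unit_square \<and> x \<noteq> y}.
                 ennreal (\<bar>f x - f y\<bar> / norm (x - y) powr (3 - \<alpha>)))"

definition Lip_space :: "real \<Rightarrow> (real \<times> real \<Rightarrow> real) set" where
  "Lip_space \<alpha> = {f \<in> cont_space unit_square. Lip \<alpha> f < \<infinity>}"

definition Lip_norm :: "real \<Rightarrow> (real \<times> real \<Rightarrow> real) \<Rightarrow> real" where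
  "Lip_norm \<alpha> f = enn2real (sup_norm f + Lip \<alpha> f)"

definition Lip_dist :: "real \<Rightarrow> (real \<times> real \<Rightarrow> real) \<Rightarrow> (real \<times> real \<Rightarrow> real) \<Rightarrow> real" where
  "Lip_dist \<alpha> f g = Lip_norm \<alpha> (f - g)"

definition Lip_topology :: "real \<Rightarrow> (real \<times> real \<Rightarrow> real) topology" where
  "Lip_topology \<alpha> = Metric_space.mtopology (Lip_space \<alpha>) (Lip_dist \<alpha>)"


section \<open>The Lipschitz spaces are completely metrizable topological vector spaces\<close>

lemma Metric_space_norm:
  fixes V :: "'a::real_vector set" and N :: "'a \<Rightarrow> real"
  assumes V: "subspace V"
    and nonneg: "\<And>x. 0 \<le> N x"
    and zero: "\<And>x. x \<in> V \<Longrightarrow> N x = 0 \<Longrightarrow> x = 0"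
    and triangle: "\<And>x y. x \<in> V \<Longrightarrow> y \<in> V \<Longrightarrow> N (x + y) \<le> N x + N y"
    and scale: "\<And>c x. N (c *\<^sub>R x) = \<bar>c\<bar> * N x"
  shows "Metric_space V (\<lambda>x y. N (x - y))"
proof
  fix x y z :: 'a
  show "0 \<le> N (x - y)" by (rule nonneg)
  show "N (x - y) = N (y - x)" using scale[of "-1" "x - y"] by simp
  show "N (x - y) = 0 \<longleftrightarrow> x = y" if "x \<in> V" "y \<in> V"
    using zero[of "x - y"] subspace_diff[OF V that] scale[of 0 0] by auto
  show "N (x - z) \<le> N (x - y) + N (y - z)" if "x \<in> V" "y \<in> V" "z \<in> V"
    using triangle[OF subspace_diff[OF V that(1,2)] subspace_diff[OF V that(2,3)]] by simp
qed

lemma completely_metrizable_tvs_norm: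
  fixes V :: "'a::real_vector set" and N :: "'a \<Rightarrow> real"
  assumes V: "subspace V"
    and nonneg: "\<And>x. 0 \<le> N x"
    and zero: "\<And>x. x \<in> V \<Longrightarrow> N x = 0 \<Longrightarrow> x = 0"
    and triangle: "\<And>x y. x \<in> V \<Longrightarrow> y \<in> V \<Longrightarrow> N (x + y) \<le> N x + N y"
    and scale: "\<And>c x. N (c *\<^sub>R x) = \<bar>c\<bar> * N x"
    and complete: "Metric_space.mcomplete V (\<lambda>x y. N (x - y))"
  shows "completely_metrizable_tvs (Metric_space.mtopology V (\<lambda>x y. N (x - y)))"
proof -
  interpret M: Metric_space V "\<lambda>x y. N (x - y)"
    by (rule Metric_space_norm) (fact V nonneg zero triangle scale)+
  have sym: "N (x - y) = N (y - x)" for x y by (rule M.commute)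
  show ?thesis
  proof
    show "subspace (topspace M.mtopology)" using V by simp
    show "completely_metrizable_space M.mtopology"
      unfolding completely_metrizable_space_def using complete M.Metric_space_axioms by blast
    show "continuous_map (prod_topology M.mtopology M.mtopology) M.mtopology (\<lambda>(x, y). x + y)"
      unfolding M.continuous_map_to_metric
    proof (intro ballI allI impI)
      fix p and e :: real
      assume p: "p \<in> topspace (prod_topology M.mtopology M.mtopology)" and e: "e > 0"
      obtain a b where ab: "p = (a, b)" "a \<in> V" "b \<in> V" using p by auto
      let ?U = "M.mball a (e/2) \<times> M.mball b (e/2)"
      have "x + y \<in> M.mball (a + b) e" if "x \<in> M.mball a (e/2)" "y \<in> M.mball b (e/2)" for x y
      proof -
        from that have x: "x \<in> V" "N (a - x) < e/2" and y: "y \<in> V" "N (b - y) < e/2" by auto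
        have "N ((a + b) - (x + y)) = N ((a - x) + (b - y))" by (simp add: algebra_simps)
        also have "\<dots> \<le> N (a - x) + N (b - y)"
          using triangle subspace_diff V ab x y by blast
        also have "\<dots> < e" using x y by simp
        finally show ?thesis using ab x y V by (simp add: subspace_add)
      qed
      moreover have "openin (prod_topology M.mtopology M.mtopology) ?U"
        by (simp add: openin_prod_Times_iff)
      moreover have "p \<in> ?U" using ab e scale[of 0 0] by simp
      ultimately show "\<exists>U. openin (prod_topology M.mtopology M.mtopology) U \<and> p \<in> U \<and>
          (\<forall>q\<in>U. (case q of (x, y) \<Rightarrow> x + y) \<in> M.mball (case p of (x, y) \<Rightarrow> x + y) e)"
        using ab by (intro exI[of _ ?U]) auto
    qed
    show "continuous_map (prod_topology euclideanreal M.mtopology) M.mtopology (\<lambda>(c, x). c *\<^sub>R x)"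
      unfolding M.continuous_map_to_metric
    proof (intro ballI allI impI)
      fix p and e :: real
      assume p: "p \<in> topspace (prod_topology euclideanreal M.mtopology)" and e: "e > 0"
      obtain c a where ca: "p = (c, a)" "a \<in> V" using p by auto
      define K where "K = 1 + \<bar>c\<bar> + N a"
      define h where "h = min 1 (e / (2 * K))"
      have K: "K > 0" using nonneg[of a] by (simp add: K_def)
      have h: "0 < h" "h \<le> 1" "h * K < e"
      proof -
        show "0 < h" "h \<le> 1" using K e by (auto simp: h_def)
        have "h * K \<le> (e / (2 * K)) * K" using K by (intro mult_right_mono) (auto simp: h_def)
        also have "\<dots> < e" using K e by simp
        finally show "h * K < e" .
      qed
      let ?U = "ball c h \<times> M.mball a h"
      have "r *\<^sub>R x \<in> M.mball (c *\<^sub>R a) e" if "r \<in> ball c h" "x \<in> M.mball a h" for r x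
      proof -
        from that have x: "x \<in> V" "N (a - x) < h" and r: "\<bar>c - r\<bar> < h" by (auto simp: dist_real_def)
        have "c *\<^sub>R a - r *\<^sub>R x = r *\<^sub>R (a - x) + (c - r) *\<^sub>R a" by (simp add: algebra_simps)
        then have "N (c *\<^sub>R a - r *\<^sub>R x) \<le> N (r *\<^sub>R (a - x)) + N ((c - r) *\<^sub>R a)"
          using triangle[of "r *\<^sub>R (a - x)" "(c - r) *\<^sub>R a"] subspace_scale subspace_diff V ca x by metis
        also have "\<dots> = \<bar>r\<bar> * N (a - x) + \<bar>c - r\<bar> * N a" by (simp add: scale)
        also have "\<dots> \<le> (\<bar>c\<bar> + 1) * h + h * N a"
          using r x h nonneg by (intro add_mono mult_mono) auto
        also have "\<dots> = h * K" by (simp add: K_def algebra_simps)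
        also have "\<dots> < e" by (rule h)
        finally show ?thesis using ca x V by (simp add: subspace_scale)
      qed
      moreover have "openin (prod_topology euclideanreal M.mtopology) ?U"
        by (simp add: openin_prod_Times_iff)
      moreover have "p \<in> ?U" using ca h scale[of 0 0] by simp
      ultimately show "\<exists>U. openin (prod_topology euclideanreal M.mtopology) U \<and> p \<in> U \<and>
          (\<forall>q\<in>U. (case q of (c, x) \<Rightarrow> c *\<^sub>R x) \<in> M.mball (case p of (c, x) \<Rightarrow> c *\<^sub>R x) e)"
        using ca by (intro exI[of _ ?U]) auto
    qed
  qed
qed

lemma sup_norm_le_iff:
  "c \<ge> 0 \<Longrightarrow> sup_norm f \<le> ennreal c \<longleftrightarrow> (\<forall>x\<in>unit_square. \<bar>f x\<bar> \<le> c)"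
  by (simp add: sup_norm_def SUP_le_iff)

lemma Lip_le_iff:
  assumes "c \<ge> 0"
  shows "Lip \<alpha> f \<le> ennreal c \<longleftrightarrow>
    (\<forall>x\<in>unit_square. \<forall>y\<in>unit_square. x \<noteq> y \<longrightarrow> \<bar>f x - f y\<bar> / norm (x - y) powr (3 - \<alpha>) \<le> c)"
proof -
  have "ennreal r \<le> ennreal c \<longleftrightarrow> r \<le> c" for r
    using assms by (simp add: ennreal_le_iff)
  then show ?thesis unfolding Lip_def SUP_le_iff by (auto simp del: ennreal_le_iff ennreal_le_iff2)
qed

lemma sup_norm_add: "sup_norm (f + g) \<le> sup_norm f + sup_norm g"
  unfolding sup_norm_def
proof (rule SUP_least)
  fix x :: "real \<times> real" assume x: "x \<in> unit_square"
  have "ennreal \<bar>(f + g) x\<bar> \<le> ennreal \<bar>f x\<bar> + ennreal \<bar>g x\<bar>"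
    by (simp flip: ennreal_plus add: ennreal_leI)
  also have "\<dots> \<le> (SUP x\<in>unit_square. ennreal \<bar>f x\<bar>) + (SUP x\<in>unit_square. ennreal \<bar>g x\<bar>)"
    using x by (intro add_mono SUP_upper)
  finally show "ennreal \<bar>(f + g) x\<bar> \<le> \<dots>" .
qed

lemma Lip_add: "Lip \<alpha> (f + g) \<le> Lip \<alpha> f + Lip \<alpha> g"
  unfolding Lip_def
proof (rule SUP_least)
  define q where "q h = (\<lambda>(x, y). ennreal (\<bar>h x - h y\<bar> / norm (x - y) powr (3 - \<alpha>)))"
    for h :: "real \<times> real \<Rightarrow> real"
  let ?D = "{(x, y). x \<in> unit_square \<and> y \<in> unit_square \<and> x \<noteq> y}"
  fix p assume p: "p \<in> ?D"
  obtain x y where xy: "p = (x, y)" by (cases p)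
  have "\<bar>(f + g) x - (f + g) y\<bar> / norm (x - y) powr (3 - \<alpha>) \<le>
      \<bar>f x - f y\<bar> / norm (x - y) powr (3 - \<alpha>) + \<bar>g x - g y\<bar> / norm (x - y) powr (3 - \<alpha>)"
    unfolding add_divide_distrib[symmetric] by (intro divide_right_mono) auto
  then have "q (f + g) p \<le> q f p + q g p"
    by (simp add: q_def xy ennreal_leI flip: ennreal_plus)
  also have "\<dots> \<le> (SUP p\<in>?D. q f p) + (SUP p\<in>?D. q g p)"
    using p by (intro add_mono SUP_upper)
  finally show "(case p of (x, y) \<Rightarrow> ennreal (\<bar>(f + g) x - (f + g) y\<bar> / norm (x - y) powr (3 - \<alpha>))) \<le>
     (SUP (x, y)\<in>?D. ennreal (\<bar>f x - f y\<bar> / norm (x - y) powr (3 - \<alpha>))) +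
     (SUP (x, y)\<in>?D. ennreal (\<bar>g x - g y\<bar> / norm (x - y) powr (3 - \<alpha>)))"
    by (simp add: q_def)
qed

lemma sup_norm_scale: "sup_norm (c *\<^sub>R f) = ennreal \<bar>c\<bar> * sup_norm f"
  by (simp add: sup_norm_def SUP_mult_left_ennreal abs_mult ennreal_mult)

lemma Lip_scale: "Lip \<alpha> (c *\<^sub>R f) = ennreal \<bar>c\<bar> * Lip \<alpha> f"
  unfolding Lip_def SUP_mult_left_ennreal
  by (intro SUP_cong refl)
    (auto simp: ennreal_mult' [symmetric] abs_mult simp flip: right_diff_distrib)

lemma sup_norm_finite: "f \<in> cont_space unit_square \<Longrightarrow> sup_norm f < \<infinity>"
proof -
  assume "f \<in> cont_space unit_square"
  then have "compact (f ` unit_square)"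
    by (intro compact_continuous_image compact_Times) (auto simp: cont_space_def)
  then obtain c where c: "\<forall>x\<in>unit_square. \<bar>f x\<bar> \<le> c"
    unfolding compact_eq_bounded_closed bounded_iff by auto
  then have "\<bar>f (0, 0)\<bar> \<le> c" by simp
  then have "c \<ge> 0" by linarith
  then have "sup_norm f \<le> ennreal c" using c by (simp add: sup_norm_le_iff)
  then show ?thesis by (simp add: le_less_trans)
qed

lemma Lip_norm_nonneg: "0 \<le> Lip_norm \<alpha> f"
  by (simp add: Lip_norm_def)

lemma Lip_norm_eq:
  "f \<in> Lip_space \<alpha> \<Longrightarrow> ennreal (Lip_norm \<alpha> f) = sup_norm f + Lip \<alpha> f"
  using sup_norm_finite[of f] by (simp add: Lip_norm_def Lip_space_def)

lemma Lip_norm_scale: "Lip_norm \<alpha> (c *\<^sub>R f) = \<bar>c\<bar> * Lip_norm \<alpha> f"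
  by (simp add: Lip_norm_def sup_norm_scale Lip_scale enn2real_mult flip: distrib_left)

lemma subspace_Lip_space: "subspace (Lip_space \<alpha>)"
  unfolding subspace_def
proof (intro conjI ballI allI)
  have "Lip \<alpha> 0 \<le> ennreal 0" by (simp add: Lip_le_iff del: ennreal_0)
  then show "0 \<in> Lip_space \<alpha>"
    by (auto simp: Lip_space_def cont_space_def zero_fun_def)
  show "f + g \<in> Lip_space \<alpha>" if "f \<in> Lip_space \<alpha>" "g \<in> Lip_space \<alpha>" for f g
  proof -
    have "Lip \<alpha> (f + g) < \<infinity>"
      using that Lip_add[of \<alpha> f g] by (auto simp: Lip_space_def intro: le_less_trans)
    then show ?thesis using that
      by (auto simp: Lip_space_def cont_space_def plus_fun_def intro: continuous_on_add)
  qed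
  show "c *\<^sub>R f \<in> Lip_space \<alpha>" if "f \<in> Lip_space \<alpha>" for c f
  proof -
    have "Lip \<alpha> (c *\<^sub>R f) < \<infinity>"
      using that by (auto simp: Lip_space_def Lip_scale ennreal_mult_less_top)
    then show ?thesis using that
      by (auto simp: Lip_space_def cont_space_def scaleR_fun_def intro!: continuous_intros)
  qed
qed

lemma abs_le_Lip_norm:
  assumes "f \<in> Lip_space \<alpha>"
  shows "\<bar>f x\<bar> \<le> Lip_norm \<alpha> f"
proof (cases "x \<in> unit_square")
  case True
  have "sup_norm f \<le> ennreal (Lip_norm \<alpha> f)" by (simp add: Lip_norm_eq[OF assms])
  then show ?thesis using True sup_norm_le_iff[OF Lip_norm_nonneg] by blast
next
  case False
  then have "f x = 0" using assms unfolding Lip_space_def cont_space_def by blast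
  then show ?thesis by (simp add: Lip_norm_nonneg)
qed

lemma Lip_le_Lip_norm:
  assumes "f \<in> Lip_space \<alpha>" "x \<in> unit_square" "y \<in> unit_square" "x \<noteq> y"
  shows "\<bar>f x - f y\<bar> / norm (x - y) powr (3 - \<alpha>) \<le> Lip_norm \<alpha> f"
proof -
  have "Lip \<alpha> f \<le> ennreal (Lip_norm \<alpha> f)" by (simp add: Lip_norm_eq[OF assms(1)])
  then show ?thesis using assms(2-) Lip_le_iff[OF Lip_norm_nonneg] by blast
qed

lemma Lip_norm_eq_0: "f \<in> Lip_space \<alpha> \<Longrightarrow> Lip_norm \<alpha> f = 0 \<Longrightarrow> f = 0"
  using abs_le_Lip_norm[of f \<alpha>] by (auto simp: fun_eq_iff)

lemma Lip_norm_triangle: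
  assumes "f \<in> Lip_space \<alpha>" "g \<in> Lip_space \<alpha>"
  shows "Lip_norm \<alpha> (f + g) \<le> Lip_norm \<alpha> f + Lip_norm \<alpha> g"
proof -
  have "ennreal (Lip_norm \<alpha> (f + g)) = sup_norm (f + g) + Lip \<alpha> (f + g)"
    using assms subspace_add[OF subspace_Lip_space] Lip_norm_eq by blast
  also have "\<dots> \<le> (sup_norm f + sup_norm g) + (Lip \<alpha> f + Lip \<alpha> g)"
    by (intro add_mono sup_norm_add Lip_add)
  also have "\<dots> = ennreal (Lip_norm \<alpha> f) + ennreal (Lip_norm \<alpha> g)"
    by (simp add: Lip_norm_eq assms algebra_simps)
  also have "\<dots> = ennreal (Lip_norm \<alpha> f + Lip_norm \<alpha> g)"
    by (simp add: Lip_norm_nonneg)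
  finally show ?thesis
    using Lip_norm_nonneg[of \<alpha> f] Lip_norm_nonneg[of \<alpha> g]
    by (subst (asm) ennreal_le_iff) auto
qed

lemma Metric_space_Lip: "Metric_space (Lip_space \<alpha>) (Lip_dist \<alpha>)"
  unfolding Lip_dist_def[abs_def]
  by (rule Metric_space_norm[where N = "Lip_norm \<alpha>"])
    (simp_all add: subspace_Lip_space Lip_norm_nonneg Lip_norm_eq_0 Lip_norm_triangle Lip_norm_scale)

lemma mcomplete_Lip: "Metric_space.mcomplete (Lip_space \<alpha>) (Lip_dist \<alpha>)"
proof -
  interpret M: Metric_space "Lip_space \<alpha>" "Lip_dist \<alpha>" by (rule Metric_space_Lip)
  have "\<exists>f. limitin M.mtopology s f sequentially" if s: "M.MCauchy s" for s
  proof -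
    have sL: "s n \<in> Lip_space \<alpha>" for n using s by (auto simp: M.MCauchy_def)
    have dL: "s n - s m \<in> Lip_space \<alpha>" for n m using sL subspace_diff subspace_Lip_space by blast
    have cau: "\<exists>n0. \<forall>n\<ge>n0. \<forall>m\<ge>n0. Lip_norm \<alpha> (s n - s m) < e" if "e > 0" for e
      using s that unfolding M.MCauchy_def Lip_dist_def by meson
    have "Cauchy (\<lambda>n. s n x)" for x
      unfolding Cauchy_def dist_real_def
    proof (intro allI impI)
      fix e :: real assume "e > 0"
      then obtain n0 where n0: "\<forall>n\<ge>n0. \<forall>m\<ge>n0. Lip_norm \<alpha> (s n - s m) < e" using cau by blast
      have "\<bar>s n x - s m x\<bar> < e" if "n \<ge> n0" "m \<ge> n0" for n m
        using abs_le_Lip_norm[OF dL, of n m x] n0 that by force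
      then show "\<exists>M. \<forall>m\<ge>M. \<forall>n\<ge>M. \<bar>s m x - s n x\<bar> < e" by blast
    qed
    then have "\<forall>x. \<exists>l. (\<lambda>n. s n x) \<longlonglongrightarrow> l" by (meson Cauchy_convergent_iff convergent_def)
    then obtain f where f: "\<And>x. (\<lambda>n. s n x) \<longlonglongrightarrow> f x" by metis
    have close: "\<exists>n0. \<forall>n\<ge>n0. (\<forall>x. \<bar>s n x - f x\<bar> \<le> e) \<and> Lip \<alpha> (s n - f) \<le> ennreal e"
      if "e > 0" for e
    proof -
      obtain n0 where n0: "\<forall>n\<ge>n0. \<forall>m\<ge>n0. Lip_norm \<alpha> (s n - s m) < e"
        using cau[OF \<open>e > 0\<close>] by blast
      have "\<bar>s n x - f x\<bar> \<le> e" if n: "n \<ge> n0" for n x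
      proof (rule LIMSEQ_le_const2)
        show "(\<lambda>m. \<bar>s n x - s m x\<bar>) \<longlonglongrightarrow> \<bar>s n x - f x\<bar>" by (intro tendsto_intros f)
        show "\<exists>N. \<forall>m\<ge>N. \<bar>s n x - s m x\<bar> \<le> e"
        proof (intro exI allI impI)
          fix m assume "m \<ge> n0"
          then have "Lip_norm \<alpha> (s n - s m) < e" using n0 n by blast
          then show "\<bar>s n x - s m x\<bar> \<le> e" using abs_le_Lip_norm[OF dL, of n m x] by simp
        qed
      qed
      moreover have "Lip \<alpha> (s n - f) \<le> ennreal e" if n: "n \<ge> n0" for n
      proof -
        have "\<bar>(s n - f) x - (s n - f) y\<bar> / norm (x - y) powr (3 - \<alpha>) \<le> e"
          if xy: "x \<in> unit_square" "y \<in> unit_square" "x \<noteq> y" for x y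
        proof (rule LIMSEQ_le_const2)
          show "(\<lambda>m. \<bar>(s n - s m) x - (s n - s m) y\<bar> / norm (x - y) powr (3 - \<alpha>)) \<longlonglongrightarrow>
              \<bar>(s n - f) x - (s n - f) y\<bar> / norm (x - y) powr (3 - \<alpha>)"
            unfolding fun_diff_def using xy by (intro tendsto_intros f) auto
          show "\<exists>N. \<forall>m\<ge>N. \<bar>(s n - s m) x - (s n - s m) y\<bar> / norm (x - y) powr (3 - \<alpha>) \<le> e"
          proof (intro exI allI impI)
            fix m assume "m \<ge> n0"
            then have "Lip_norm \<alpha> (s n - s m) < e" using n0 n by blast
            then show "\<bar>(s n - s m) x - (s n - s m) y\<bar> / norm (x - y) powr (3 - \<alpha>) \<le> e"
              using Lip_le_Lip_norm[OF dL xy, of n m] by linarith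
          qed
        qed
        then show ?thesis using Lip_le_iff[OF less_imp_le[OF \<open>e > 0\<close>]] by blast
      qed
      ultimately show ?thesis by blast
    qed
    have "uniform_limit unit_square s f sequentially"
      unfolding uniform_limit_sequentially_iff dist_real_def
    proof (intro allI impI)
      fix e :: real assume "e > 0"
      then obtain n0 where "\<forall>n\<ge>n0. \<forall>x. \<bar>s n x - f x\<bar> \<le> e/2" using close[of "e/2"] by auto
      then show "\<exists>N. \<forall>n\<ge>N. \<forall>x\<in>unit_square. \<bar>s n x - f x\<bar> < e"
        using \<open>e > 0\<close> by (metis half_gt_zero_iff field_sum_of_halves le_less_trans less_add_same_cancel1)
    qed
    then have "continuous_on unit_square f"
      using sL by (intro uniform_limit_theorem[of _ s sequentially])
        (auto simp: Lip_space_def cont_space_def)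
    moreover have "f x = 0" if "x \<notin> unit_square" for x
    proof (rule LIMSEQ_unique[OF f])
      have "s n x = 0" for n using sL[of n] that unfolding Lip_space_def cont_space_def by blast
      then show "(\<lambda>n. s n x) \<longlonglongrightarrow> 0" by simp
    qed
    ultimately have fC: "f \<in> cont_space unit_square" by (simp add: cont_space_def)
    have fL: "f \<in> Lip_space \<alpha>"
    proof -
      obtain n where n: "Lip \<alpha> (s n - f) \<le> ennreal 1" using close[of 1] by auto
      have "s n - f \<in> cont_space unit_square"
        using sL[of n] fC
        by (auto simp: Lip_space_def cont_space_def fun_diff_def intro: continuous_on_diff)
      then have "s n - f \<in> Lip_space \<alpha>" using n by (simp add: Lip_space_def le_less_trans)
      then have "s n - (s n - f) \<in> Lip_space \<alpha>" using sL subspace_diff subspace_Lip_space by blast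
      then show ?thesis by simp
    qed
    have "\<exists>n0. \<forall>n\<ge>n0. s n \<in> Lip_space \<alpha> \<and> Lip_dist \<alpha> (s n) f < e" if e: "e > 0" for e
    proof -
      obtain n0 where n0: "\<forall>n\<ge>n0. (\<forall>x. \<bar>s n x - f x\<bar> \<le> e/3) \<and> Lip \<alpha> (s n - f) \<le> ennreal (e/3)"
        using close[of "e/3"] e by auto
      have "Lip_dist \<alpha> (s n) f < e" if n: "n \<ge> n0" for n
      proof -
        have "s n - f \<in> Lip_space \<alpha>" using sL fL subspace_diff subspace_Lip_space by blast
        then have "ennreal (Lip_norm \<alpha> (s n - f)) = sup_norm (s n - f) + Lip \<alpha> (s n - f)"
          by (rule Lip_norm_eq)
        also have "\<dots> \<le> ennreal (e/3) + ennreal (e/3)"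
          using n0 n e by (intro add_mono) (auto simp: sup_norm_le_iff)
        also have "\<dots> = ennreal (e/3 + e/3)" using e by (intro ennreal_plus[symmetric]) auto
        finally have "Lip_norm \<alpha> (s n - f) \<le> e/3 + e/3" using e by (simp add: ennreal_le_iff)
        then show ?thesis using e by (simp add: Lip_dist_def)
      qed
      then show ?thesis using sL by blast
    qed
    then show ?thesis unfolding M.limit_metric_sequentially using fL by blast
  qed
  then show ?thesis by (simp add: M.mcomplete_def)
qed

lemma completely_metrizable_tvs_Lip: "completely_metrizable_tvs (Lip_topology \<alpha>)"
  unfolding Lip_topology_def Lip_dist_def[abs_def]
  by (rule completely_metrizable_tvs_norm[where N = "Lip_norm \<alpha>"])
    (use mcomplete_Lip in \<open>simp_all add: subspace_Lip_space Lip_norm_nonneg Lip_norm_eq_0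
      Lip_norm_triangle Lip_norm_scale Lip_dist_def[abs_def]\<close>)

lemma topspace_Lip_topology: "topspace (Lip_topology \<alpha>) = Lip_space \<alpha>"
  by (simp add: Lip_topology_def Metric_space.topspace_mtopology[OF Metric_space_Lip])

end

theory Submission
  imports Defs "HOL-Real_Asymp.Real_Asymp"
begin

text \<open>Put \<open>s = 3 - \<alpha>\<close>. Every \<open>f \<in> L\<^sub>\<alpha>\<close> is \<open>s\<close>-Hoelder, and so is its horizon, which bounds both upper box
  dimensions; only the lower ones matter. The probe is spanned by \<open>(x, y) \<mapsto> \<phi> x\<close>, where
  \<open>\<phi> x = (\<Sum>k. (k + 1)\<^sup>-\<^sup>2 2\<^sup>-\<^sup>k\<^sup>s \<tau> (2\<^sup>k x))\<close> is of Takagi type, \<open>\<tau>\<close> being the distance to the nearest integer. As this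
  function does not depend on \<open>y\<close>, \<open>H (f + t \<phi>) = H f + t \<phi>\<close>. The second difference of \<open>\<phi>\<close> over each
  dyadic interval of length \<open>2\<^sup>-\<^sup>n\<close> sees the \<open>n\<close>-th summand only. The sum \<open>G\<^sub>n t\<close> of the absolute
  second differences of \<open>h + t \<phi>\<close> satisfies \<open>G\<^sub>n t + G\<^sub>n t' \<ge> \<bar>t - t'\<bar> V\<^sub>n\<close>, where \<open>V\<^sub>n\<close> is that of \<open>\<phi>\<close>, so
  \<open>G\<^sub>n t < \<epsilon> V\<^sub>n\<close> holds only on a set of measure \<open>O(\<epsilon>)\<close>. With \<open>\<epsilon> = (n + 1)\<^sup>-\<^sup>2\<close>, Borel--Cantelli bounds
  the mesh counts from below for almost every \<open>t\<close>. The weights \<open>(k + 1)\<^sup>-\<^sup>2\<close> keep \<open>\<phi>\<close> \<open>s\<close>-Hoelder and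
  continuous for all \<open>s \<in> [0, 1]\<close>, at the cost of a factor that is negligible for dimensions.\<close>

section \<open>Mesh counts and box dimension\<close>

definition mesh_cubes :: "real \<Rightarrow> 'a::euclidean_space set \<Rightarrow> 'a set set" where
  "mesh_cubes \<delta> F = {Q \<in> range (mesh_cube \<delta>). Q \<inter> F \<noteq> {}}"

lemma mesh_count_eq: "mesh_count \<delta> F = card (mesh_cubes \<delta> F)"
  by (simp add: mesh_count_def mesh_cubes_def)

lemma mesh_cube_nonempty:
  fixes k :: "'a::euclidean_space \<Rightarrow> int"
  assumes "\<delta> > 0"
  shows "mesh_cube \<delta> k \<noteq> {}"
proof -
  have "(\<Sum>b\<in>Basis. (of_int (k b) * \<delta>) *\<^sub>R b) \<in> mesh_cube \<delta> k"
    using assms by (simp add: mesh_cube_def inner_sum_left_Basis)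
  then show ?thesis by blast
qed

lemma mem_mesh_cube_floor:
  fixes x :: "'a::euclidean_space"
  assumes "\<delta> > 0"
  shows "x \<in> mesh_cube \<delta> (\<lambda>b. \<lfloor>x \<bullet> b / \<delta>\<rfloor>)"
proof -
  have "of_int \<lfloor>x \<bullet> b / \<delta>\<rfloor> * \<delta> \<le> x \<bullet> b \<and> x \<bullet> b \<le> (of_int \<lfloor>x \<bullet> b / \<delta>\<rfloor> + 1) * \<delta>" for b
    using floor_correct[of "x \<bullet> b / \<delta>"]
    by (simp add: assms less_imp_le flip: pos_le_divide_eq[OF assms] pos_divide_le_eq[OF assms])
  then show ?thesis by (simp add: mesh_cube_def)
qed

lemma closed_mesh_cube: "closed (mesh_cube \<delta> (k :: 'a::euclidean_space \<Rightarrow> int))"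
proof -
  have "mesh_cube \<delta> k = (\<Inter>b\<in>Basis. {x. of_int (k b) * \<delta> \<le> x \<bullet> b} \<inter> {x. x \<bullet> b \<le> (of_int (k b) + 1) * \<delta>})"
    by (auto simp: mesh_cube_def)
  moreover have "closed \<dots>"
    by (intro closed_INT ballI closed_Int closed_Collect_le continuous_intros)
  ultimately show ?thesis by simp
qed

text \<open>Along one axis, a closed mesh interval with index \<open>k b\<close> meets
  \<open>[a b, a b + w]\<close> only if
  \<open>a b / \<delta> - 1 \<le> k b \<le> (a b + w) / \<delta>\<close>, which leaves at most
  \<open>w / \<delta> + 2\<close> indices. The choices multiply over the axes.\<close>

lemma mesh_cubes_card_le:
  fixes F :: "'a::euclidean_space set"
  assumes F: "\<And>x b. x \<in> F \<Longrightarrow> b \<in> Basis \<Longrightarrow> a b \<le> x \<bullet> b \<and> x \<bullet> b \<le> a b + w"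
    and \<delta>: "\<delta> > 0" and w: "w \<ge> 0"
  shows "finite (mesh_cubes \<delta> F)" "real (mesh_count \<delta> F) \<le> (w / \<delta> + 2) ^ DIM('a)"
proof -
  define K where "K b = {\<lceil>a b / \<delta> - 1\<rceil>..\<lfloor>(a b + w) / \<delta>\<rfloor>}" for b
  have sub: "mesh_cubes \<delta> F \<subseteq> mesh_cube \<delta> ` (PiE Basis K)"
  proof
    fix Q assume "Q \<in> mesh_cubes \<delta> F"
    then obtain k x where Q: "Q = mesh_cube \<delta> k" and x: "x \<in> Q" "x \<in> F"
      by (auto simp: mesh_cubes_def)
    have "k b \<in> K b" if b: "b \<in> Basis" for b
    proof -
      have "of_int (k b) * \<delta> \<le> x \<bullet> b" "x \<bullet> b \<le> (of_int (k b) + 1) * \<delta>"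
        using x(1) b by (auto simp: Q mesh_cube_def)
      then have "of_int (k b) * \<delta> \<le> a b + w" "a b \<le> (of_int (k b) + 1) * \<delta>"
        using F[OF x(2) b] by auto
      then have "of_int (k b) \<le> (a b + w) / \<delta>" "a b / \<delta> - 1 \<le> of_int (k b)"
        using \<delta> by (simp_all add: field_simps)
      then show ?thesis unfolding K_def atLeastAtMost_iff le_floor_iff ceiling_le_iff by blast
    qed
    \<comment> \<open>A cube depends only on the values of its index on \<open>Basis\<close>; fixing
      the others makes the set of indices finite.\<close>
    then have "restrict k Basis \<in> PiE Basis K" by auto
    moreover have "Q = mesh_cube \<delta> (restrict k Basis)" by (simp add: Q mesh_cube_def)
    ultimately show "Q \<in> mesh_cube \<delta> ` (PiE Basis K)" by blast
  qed
  have fin: "finite (PiE Basis K)" by (intro finite_PiE) (auto simp: K_def)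
  then show "finite (mesh_cubes \<delta> F)" using sub finite_subset by blast
  have card_K: "real (card (K b)) \<le> w / \<delta> + 2" for b
  proof -
    have "0 \<le> w / \<delta>" using \<delta> w by simp
    moreover have "of_int \<lfloor>(a b + w) / \<delta>\<rfloor> - of_int \<lceil>a b / \<delta> - 1\<rceil> + 1 \<le> w / \<delta> + (2::real)"
      using of_int_floor_le[of "(a b + w) / \<delta>"] le_of_int_ceiling[of "a b / \<delta> - 1"]
      unfolding add_divide_distrib by linarith
    ultimately show ?thesis by (simp add: K_def)
  qed
  have "real (mesh_count \<delta> F) \<le> real (card (mesh_cube \<delta> ` (PiE Basis K)))"
    unfolding mesh_count_eq using sub fin by (intro of_nat_mono card_mono) auto
  also have "\<dots> \<le> real (card (PiE Basis K))" using fin by (intro of_nat_mono card_image_le)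
  also have "\<dots> = (\<Prod>b\<in>Basis. real (card (K b)))" by (simp add: card_PiE)
  also have "\<dots> \<le> (\<Prod>b\<in>(Basis::'a set). w / \<delta> + 2)" by (intro prod_mono) (auto simp: card_K)
  finally show "real (mesh_count \<delta> F) \<le> (w / \<delta> + 2) ^ DIM('a)" by simp
qed

lemma finite_mesh_cubes:
  fixes F :: "'a::euclidean_space set"
  assumes "bounded F" "\<delta> > 0"
  shows "finite (mesh_cubes \<delta> F)"
proof -
  obtain B where B: "B > 0" "\<And>x. x \<in> F \<Longrightarrow> norm x \<le> B" using assms(1) bounded_pos by metis
  have "- B \<le> x \<bullet> b \<and> x \<bullet> b \<le> - B + 2 * B" if "x \<in> F" "b \<in> Basis" for x b
    using Basis_le_norm[of b x] B(2)[OF that(1)] that(2) by linarith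
  then show ?thesis using B(1) assms(2) by (intro mesh_cubes_card_le(1)[where a = "\<lambda>_. - B" and w = "2 * B"]) auto
qed

lemma mesh_count_pos:
  assumes "bounded F" "F \<noteq> {}" "\<delta> > 0"
  shows "mesh_count \<delta> F > 0"
proof -
  obtain x where "x \<in> F" using assms by blast
  then have "mesh_cubes \<delta> F \<noteq> {}" using mem_mesh_cube_floor[OF assms(3), of x]
    by (auto simp: mesh_cubes_def)
  then show ?thesis using finite_mesh_cubes[OF assms(1,3)] by (simp add: mesh_count_eq card_gt_0_iff)
qed

text \<open>A cube of side \<open>\<delta> \<le> \<eta>\<close> meets at most three intervals of the
  coarse mesh along each axis. This lets dyadic scales stand in for all scales.\<close>

lemma mesh_count_coarser:
  fixes F :: "'a::euclidean_space set"
  assumes F: "bounded F" and \<delta>: "0 < \<delta>" "\<delta> \<le> \<eta>"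
  shows "mesh_count \<eta> F \<le> 3 ^ DIM('a) * mesh_count \<delta> F"
proof -
  have fin: "finite (mesh_cubes \<delta> F)" using finite_mesh_cubes F \<delta> by blast
  have one: "finite (mesh_cubes \<eta> Q)" "card (mesh_cubes \<eta> Q) \<le> 3 ^ DIM('a)"
    if Q_mem: "Q \<in> mesh_cubes \<delta> F" for Q
  proof -
    obtain k where Q: "Q = mesh_cube \<delta> k" using Q_mem by (auto simp: mesh_cubes_def)
    have Qb: "of_int (k b) * \<delta> \<le> x \<bullet> b \<and> x \<bullet> b \<le> of_int (k b) * \<delta> + \<delta>"
      if "x \<in> Q" "b \<in> Basis" for x b
      using that by (auto simp: Q mesh_cube_def algebra_simps)
    show "finite (mesh_cubes \<eta> Q)" using mesh_cubes_card_le(1)[OF Qb] \<delta> by auto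
    have "real (mesh_count \<eta> Q) \<le> (\<delta> / \<eta> + 2) ^ DIM('a)"
      using mesh_cubes_card_le(2)[OF Qb] \<delta> by auto
    also have "\<dots> \<le> 3 ^ DIM('a)" using \<delta> by (intro power_mono) auto
    finally show "card (mesh_cubes \<eta> Q) \<le> 3 ^ DIM('a)"
      unfolding mesh_count_eq by (metis of_nat_le_iff of_nat_numeral of_nat_power)
  qed
  have "mesh_cubes \<eta> F \<subseteq> (\<Union>Q\<in>mesh_cubes \<delta> F. mesh_cubes \<eta> Q)"
  proof
    fix R assume "R \<in> mesh_cubes \<eta> F"
    then obtain x where x: "R \<in> range (mesh_cube \<eta>)" "x \<in> R" "x \<in> F" by (auto simp: mesh_cubes_def)
    then show "R \<in> (\<Union>Q\<in>mesh_cubes \<delta> F. mesh_cubes \<eta> Q)"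
      using mem_mesh_cube_floor[OF \<delta>(1), of x] unfolding mesh_cubes_def by blast
  qed
  then have "card (mesh_cubes \<eta> F) \<le> card (\<Union>Q\<in>mesh_cubes \<delta> F. mesh_cubes \<eta> Q)"
    using fin one by (intro card_mono) auto
  also have "\<dots> \<le> (\<Sum>Q\<in>mesh_cubes \<delta> F. card (mesh_cubes \<eta> Q))" by (rule card_UN_le[OF fin])
  also have "\<dots> \<le> (\<Sum>Q\<in>mesh_cubes \<delta> F. 3 ^ DIM('a))" by (intro sum_mono one)
  finally show ?thesis by (simp add: mesh_count_eq mult.commute)
qed

section \<open>Product meshes and columns over a base cube\<close>

lemma mesh_cube_prod:
  fixes k :: "'a::euclidean_space \<times> 'b::euclidean_space \<Rightarrow> int"
  shows "mesh_cube \<delta> k = mesh_cube \<delta> (\<lambda>b. k (b, 0)) \<times> mesh_cube \<delta> (\<lambda>b. k (0, b))"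
  by (simp add: mesh_cube_def Basis_prod_def ball_Un set_eq_iff)

lemma range_mesh_cube_prod:
  "range (mesh_cube \<delta> :: ('a::euclidean_space \<times> 'b::euclidean_space \<Rightarrow> int) \<Rightarrow> _) =
     (\<lambda>(Q, R). Q \<times> R) ` (range (mesh_cube \<delta>) \<times> range (mesh_cube \<delta>))"
proof (intro equalityI subsetI)
  fix X assume "X \<in> (\<lambda>(Q, R). Q \<times> R) ` (range (mesh_cube \<delta> :: ('a \<Rightarrow> int) \<Rightarrow> _) \<times> range (mesh_cube \<delta> :: ('b \<Rightarrow> int) \<Rightarrow> _))"
  then obtain k :: "'a \<Rightarrow> int" and l :: "'b \<Rightarrow> int" where X: "X = mesh_cube \<delta> k \<times> mesh_cube \<delta> l" by auto
  \<comment> \<open>Basis vectors of the product are \<open>(a, 0)\<close> or \<open>(0, b)\<close>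
    with \<open>b \<noteq> 0\<close>, so the second component tells which index applies.\<close>
  have "X = mesh_cube \<delta> (\<lambda>(a, b). if b = 0 then k a else l b)"
    unfolding mesh_cube_prod X by (auto simp: mesh_cube_def)
  then show "X \<in> range (mesh_cube \<delta>)" by blast
qed (auto simp: mesh_cube_prod)

lemma mesh_count_graph_on:
  fixes S :: "'a::euclidean_space set"
  assumes \<delta>: "\<delta> > 0" and S: "bounded S" and f: "bounded (f ` S)"
  shows "mesh_count \<delta> (graph_on S f) = (\<Sum>Q\<in>mesh_cubes \<delta> S. mesh_count \<delta> (f ` (Q \<inter> S)))"
proof -
  let ?A = "SIGMA Q:mesh_cubes \<delta> S. mesh_cubes \<delta> (f ` (Q \<inter> S))"
  have "mesh_cubes \<delta> (graph_on S f) = (\<lambda>(Q, R). Q \<times> R) ` ?A"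
    unfolding mesh_cubes_def range_mesh_cube_prod graph_on_def by (auto simp: image_iff)
  moreover have "inj_on (\<lambda>(Q, R). Q \<times> R) ?A"
    using mesh_cube_nonempty[OF \<delta>] by (auto simp: inj_on_def mesh_cubes_def times_eq_iff)
  moreover have "finite (mesh_cubes \<delta> (f ` (Q \<inter> S)))" for Q
    using \<delta> f by (intro finite_mesh_cubes) (auto intro: bounded_subset)
  ultimately show ?thesis
    using finite_mesh_cubes[OF S \<delta>] by (simp add: mesh_count_eq card_image card_SigmaI)
qed

text \<open>For \<open>a \<le> b\<close>, connectedness puts the whole interval from
  \<open>a\<close> to \<open>b\<close> into \<open>F\<close>, and it meets every mesh interval with
  index from \<open>\<lfloor>a / \<delta>\<rfloor>\<close> to
  \<open>\<lfloor>b / \<delta>\<rfloor>\<close>.\<close>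

lemma mesh_count_interval_ge:
  fixes F :: "real set"
  assumes \<delta>: "\<delta> > 0" and F: "connected F" "bounded F" "a \<in> F" "b \<in> F"
  shows "\<bar>a - b\<bar> / \<delta> \<le> real (mesh_count \<delta> F)"
  using F(3,4)
proof (induction a b rule: linorder_wlog)
  case (le a b)
  define c where "c j = {of_int j * \<delta>..(of_int j + 1) * \<delta>}" for j
  have c: "c j = mesh_cube \<delta> (\<lambda>_. j)" for j by (auto simp: c_def mesh_cube_def)
  have "inj c"
    using \<delta> by (intro injI) (simp add: c_def Icc_eq_Icc)
  moreover have "c ` {\<lfloor>a / \<delta>\<rfloor>..\<lfloor>b / \<delta>\<rfloor>} \<subseteq> mesh_cubes \<delta> F"
  proof
    fix Q assume "Q \<in> c ` {\<lfloor>a / \<delta>\<rfloor>..\<lfloor>b / \<delta>\<rfloor>}"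
    then obtain j where j: "Q = c j" "\<lfloor>a / \<delta>\<rfloor> \<le> j" "j \<le> \<lfloor>b / \<delta>\<rfloor>" by auto
    have 1: "a \<le> (of_int j + 1) * \<delta>"
    proof -
      have "a / \<delta> \<le> of_int j + 1" using j(2) by linarith
      then show ?thesis using \<delta> by (simp add: field_simps)
    qed
    have 2: "of_int j * \<delta> \<le> b"
    proof -
      have "of_int j \<le> b / \<delta>" using j(3) by linarith
      then show ?thesis using \<delta> by (simp add: field_simps)
    qed
    \<comment> \<open>This point witnesses that the \<open>j\<close>-th interval is hit: its left
      end, or \<open>a\<close> if that lies further right.\<close>
    have "max a (of_int j * \<delta>) \<in> F"
      using F(1) le 2 unfolding is_interval_connected_1[symmetric] is_interval_1
      by (smt (verit, best))
    moreover have "max a (of_int j * \<delta>) \<in> Q" using 1 \<delta> by (auto simp: j c_def algebra_simps)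
    ultimately show "Q \<in> mesh_cubes \<delta> F" by (auto simp: mesh_cubes_def j(1) c)
  qed
  ultimately have "card {\<lfloor>a / \<delta>\<rfloor>..\<lfloor>b / \<delta>\<rfloor>} \<le> mesh_count \<delta> F"
    unfolding mesh_count_eq using finite_mesh_cubes[OF F(2) \<delta>]
    by (metis card_image card_mono inj_on_subset subset_UNIV)
  moreover have "b / \<delta> - a / \<delta> \<le> real (card {\<lfloor>a / \<delta>\<rfloor>..\<lfloor>b / \<delta>\<rfloor>})"
    by simp linarith
  moreover have "\<bar>a - b\<bar> / \<delta> = b / \<delta> - a / \<delta>" using le by (simp add: diff_divide_distrib)
  ultimately show ?case by linarith
next
  case (sym a b)
  then show ?case by (simp add: abs_minus_commute)
qed

section \<open>Box dimension through bounds on mesh counts\<close>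

text \<open>Replaces a lower limit over all real scales by countably many conditions on dyadic mesh
  counts. Measurability needs the countability, and the estimates along the probe are made at dyadic
  scales only.\<close>

lemma lower_box_dim_ge_iff:
  fixes F :: "'a::euclidean_space set"
  assumes F: "bounded F" "F \<noteq> {}"
  shows "ereal s \<le> lower_box_dim F \<longleftrightarrow>
    (\<forall>m::nat. \<forall>\<^sub>F n in sequentially. 2 powr (real n * (s - 1 / (real m + 1))) \<le> real (mesh_count (1 / 2 ^ n) F))"
    (is "_ \<longleftrightarrow> ?R")
proof
  have pos: "real (mesh_count \<delta> F) > 0" if "\<delta> > 0" for \<delta>
    using mesh_count_pos[OF F that] by simp
  have lim: "filterlim (\<lambda>n. 1 / 2 ^ n :: real) (at_right 0) sequentially"
    by real_asymp
  show ?R if lower: "ereal s \<le> lower_box_dim F"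
  proof
    fix m :: nat
    define t where "t = s - 1 / (real m + 1)"
    have "ereal t < ereal s" by (simp add: t_def)
    then have "ereal t < lower_box_dim F" using lower by (rule less_le_trans)
    then have "\<forall>\<^sub>F \<delta> in at_right 0. ereal t < ereal (ln (real (mesh_count \<delta> F)) / (- ln \<delta>))"
      unfolding lower_box_dim_def by (rule less_LiminfD)
    then have "\<forall>\<^sub>F n in sequentially. t < ln (real (mesh_count (1 / 2 ^ n) F)) / (- ln (1 / 2 ^ n))"
      using eventually_compose_filterlim[OF _ lim] by auto
    then show "\<forall>\<^sub>F n in sequentially. 2 powr (real n * t) \<le> real (mesh_count (1 / 2 ^ n) F)"
      using eventually_gt_at_top[of 0]
    proof eventually_elim
      case (elim n)
      have "- ln (1 / 2 ^ n) = real n * ln 2" by (simp add: ln_div ln_realpow)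
      then have "real n * t * ln 2 < ln (real (mesh_count (1 / 2 ^ n) F))"
        using elim by (simp add: field_simps)
      then show ?case using pos[of "1 / 2 ^ n"] by (simp add: powr_def flip: ln_ge_iff)
    qed
  qed
  show "ereal s \<le> lower_box_dim F" if R: ?R
  proof (rule dense_le)
    fix z assume "z < ereal s"
    show "z \<le> lower_box_dim F"
    proof (cases z)
      case (real r)
      then have "r < s" using \<open>z < ereal s\<close> by simp
      then obtain m :: nat where m: "1 / (real m + 1) < s - r"
        using reals_Archimedean[of "s - r"] by (auto simp: inverse_eq_divide add.commute)
      define t where "t = s - 1 / (real m + 1)"
      define C where "C = real DIM('a) * ln 3"
      have "r < t" using m unfolding t_def by (simp add: add.commute)
      have dyadic: "\<forall>\<^sub>F n in sequentially. 2 powr (real n * t) \<le> real (mesh_count (1 / 2 ^ n) F)"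
        using R unfolding t_def by (simp add: add.commute)
      \<comment> \<open>\<open>1 / 2 ^ \<nu> \<delta>\<close> is the smallest such dyadic scale not
        below \<open>\<delta>\<close>, for \<open>\<delta> < 1\<close>.\<close>
      define \<nu> where "\<nu> \<delta> = nat \<lfloor>log 2 (1 / \<delta>)\<rfloor>" for \<delta> :: real
      have "filterlim \<nu> sequentially (at_right 0)"
        unfolding \<nu>_def by real_asymp
      then have "\<forall>\<^sub>F \<delta> in at_right 0. 2 powr (real (\<nu> \<delta>) * t) \<le> real (mesh_count (1 / 2 ^ \<nu> \<delta>) F)"
        using eventually_compose_filterlim[OF dyadic] by blast
      moreover have "\<forall>\<^sub>F \<delta>::real in at_right 0. 0 < \<delta> \<and> \<delta> < 1"
        by (auto simp: eventually_at_right_field intro: exI[of _ 1])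
      \<comment> \<open>The gap \<open>t - r > 0\<close> eventually pays for two bounded losses:
        \<open>\<bar>t\<bar> * ln 2\<close> from rounding the scale, where \<open>t\<close> may have
        either sign, and \<open>C\<close> from comparing the two meshes.\<close>
      moreover have "\<forall>\<^sub>F \<delta> in at_right 0. r * (- ln \<delta>) \<le> t * (- ln \<delta>) - \<bar>t\<bar> * ln 2 - C"
        using \<open>r < t\<close> by real_asymp
      ultimately have "\<forall>\<^sub>F \<delta> in at_right 0. ereal r \<le> ereal (ln (real (mesh_count \<delta> F)) / (- ln \<delta>))"
      proof eventually_elim
        case (elim \<delta>)
        let ?n = "\<nu> \<delta>"
        have L: "log 2 (1 / \<delta>) > 0" using elim by simp
        then have n: "real ?n \<le> log 2 (1 / \<delta>)" "log 2 (1 / \<delta>) < real ?n + 1"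
          unfolding \<nu>_def by linarith+
        have lnd: "log 2 (1 / \<delta>) * ln 2 = - ln \<delta>" using elim by (simp add: log_def ln_div)
        have "2 powr real ?n \<le> 2 powr log 2 (1 / \<delta>)" using n by simp
        then have "2 ^ ?n \<le> 1 / \<delta>" using elim by (simp add: powr_realpow)
        then have le: "\<delta> \<le> 1 / 2 ^ ?n" using elim by (simp add: field_simps)
        have "real (mesh_count (1 / 2 ^ ?n) F) \<le> real (3 ^ DIM('a) * mesh_count \<delta> F)"
          using mesh_count_coarser[OF F(1) _ le] elim by (intro of_nat_mono) auto
        then have "2 powr (real ?n * t) \<le> 3 ^ DIM('a) * real (mesh_count \<delta> F)"
          using elim by simp
        then have "ln (2 powr (real ?n * t)) \<le> ln (3 ^ DIM('a) * real (mesh_count \<delta> F))"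
          using pos elim by (subst ln_le_cancel_iff) auto
        then have "real ?n * t * ln 2 \<le> C + ln (real (mesh_count \<delta> F))"
          using pos elim by (simp add: ln_mult ln_realpow C_def ln_powr)
        moreover have "t * (- ln \<delta>) - \<bar>t\<bar> * ln 2 \<le> real ?n * t * ln 2"
        proof -
          have "(log 2 (1 / \<delta>) - real ?n) * t \<le> 1 * \<bar>t\<bar>"
            using n by (intro order.trans[OF mult_left_mono[OF abs_ge_self] mult_right_mono]) auto
          then have "((log 2 (1 / \<delta>) - real ?n) * t) * ln 2 \<le> \<bar>t\<bar> * ln 2"
            by (intro mult_right_mono) auto
          then show ?thesis unfolding lnd[symmetric] by (simp add: algebra_simps)
        qed
        ultimately have "r * (- ln \<delta>) \<le> ln (real (mesh_count \<delta> F))" using elim by linarith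
        moreover have "- ln \<delta> > 0" using elim by simp
        ultimately show ?case by (simp only: ereal_less_eq pos_le_divide_eq)
      qed
      then show ?thesis unfolding lower_box_dim_def real by (rule Liminf_bounded)
    qed (use \<open>z < ereal s\<close> in auto)
  qed
qed

lemma upper_box_dim_le:
  fixes F :: "'a::euclidean_space set"
  assumes F: "bounded F" "F \<noteq> {}"
    and le: "\<forall>\<^sub>F \<delta> in at_right 0. real (mesh_count \<delta> F) \<le> C * \<delta> powr (- s)"
  shows "upper_box_dim F \<le> ereal s"
proof (rule dense_ge)
  fix z assume "ereal s < z"
  show "upper_box_dim F \<le> z"
  proof (cases z)
    case (real r)
    then have "s < r" using \<open>ereal s < z\<close> by simp
    \<comment> \<open>\<open>max C 1\<close> gives the logarithm a positive argument whatever the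
      sign of \<open>C\<close>.\<close>
    then have "\<forall>\<^sub>F \<delta> in at_right 0. ln (max C 1) + s * (- ln \<delta>) \<le> r * (- ln \<delta>)"
      by real_asymp
    moreover have "\<forall>\<^sub>F \<delta>::real in at_right 0. 0 < \<delta> \<and> \<delta> < 1"
      by (auto simp: eventually_at_right_field intro: exI[of _ 1])
    ultimately have "\<forall>\<^sub>F \<delta> in at_right 0. ereal (ln (real (mesh_count \<delta> F)) / (- ln \<delta>)) \<le> ereal r"
      using le
    proof eventually_elim
      case (elim \<delta>)
      then have "0 < real (mesh_count \<delta> F)" using mesh_count_pos[OF F] by simp
      moreover have "real (mesh_count \<delta> F) \<le> max C 1 * \<delta> powr (- s)"
        using elim by (auto intro: order.trans mult_right_mono)
      ultimately have "ln (real (mesh_count \<delta> F)) \<le> ln (max C 1 * \<delta> powr (- s))"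
        by (subst ln_le_cancel_iff) auto
      also have "\<dots> = ln (max C 1) + s * (- ln \<delta>)"
        using elim by (subst ln_mult) (auto simp: ln_powr)
      also have "\<dots> \<le> r * (- ln \<delta>)" by (rule elim)
      finally have "ln (real (mesh_count \<delta> F)) \<le> r * (- ln \<delta>)" .
      moreover have "- ln \<delta> > 0" using elim by simp
      ultimately show ?case by (simp only: ereal_less_eq pos_divide_le_eq)
    qed
    then show ?thesis unfolding upper_box_dim_def real by (rule Limsup_bounded)
  qed (use \<open>ereal s < z\<close> in auto)
qed

lemma has_box_dim_iff_lower:
  assumes "upper_box_dim F \<le> ereal s"
  shows "has_box_dim F s \<longleftrightarrow> ereal s \<le> lower_box_dim F"
proof -
  have "lower_box_dim F \<le> upper_box_dim F"
    unfolding lower_box_dim_def upper_box_dim_def by (intro Liminf_le_Limsup) simp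
  then show ?thesis using assms unfolding has_box_dim_def by auto
qed

section \<open>Upper box dimension of Hoelder graphs\<close>

lemma mesh_count_unit_box:
  fixes S :: "'a::euclidean_space set"
  assumes S: "\<And>x b. x \<in> S \<Longrightarrow> b \<in> Basis \<Longrightarrow> 0 \<le> x \<bullet> b \<and> x \<bullet> b \<le> 1"
    and \<delta>: "0 < \<delta>" "\<delta> \<le> 1"
  shows "real (mesh_count \<delta> S) \<le> (3 / \<delta>) ^ DIM('a)"
proof -
  have "real (mesh_count \<delta> S) \<le> (1 / \<delta> + 2) ^ DIM('a)"
    using S \<delta> by (intro mesh_cubes_card_le(2)[where a = "\<lambda>_. 0"]) auto
  also have "\<dots> \<le> (3 / \<delta>) ^ DIM('a)"
    using \<delta> by (intro power_mono) (auto simp: field_simps)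
  finally show ?thesis .
qed

text \<open>Over a base cube of side \<open>\<delta>\<close> the function oscillates by
  \<open>O(\<delta> powr s)\<close>, so its column holds \<open>O(\<delta> powr (s - 1))\<close>
  cubes. With \<open>d = DIM('a)\<close> there are \<open>O(\<delta> powr (- d))\<close> base
  cubes.\<close>

lemma upper_box_dim_graph_Hoelder:
  fixes S :: "'a::euclidean_space set" and f :: "'a \<Rightarrow> real" and s L :: real
  assumes S: "\<And>x b. x \<in> S \<Longrightarrow> b \<in> Basis \<Longrightarrow> 0 \<le> x \<bullet> b \<and> x \<bullet> b \<le> 1" "S \<noteq> {}"
    and s: "0 \<le> s" "s \<le> 1" and L: "L \<ge> 0" and bf: "bounded (f ` S)"
    and f: "\<And>x y. x \<in> S \<Longrightarrow> y \<in> S \<Longrightarrow> x \<noteq> y \<Longrightarrow> \<bar>f x - f y\<bar> \<le> L * norm (x - y) powr s"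
  shows "upper_box_dim (graph_on S f) \<le> ereal (DIM('a) + 1 - s)"
proof -
  define d where "d = real DIM('a)"
  define C where "C = 3 ^ DIM('a) * (2 * L * d powr s + 2)"
  have d: "d > 0" by (simp add: d_def)
  have bS: "bounded S"
  proof -
    have "norm x \<le> d" if "x \<in> S" for x
    proof -
      have "norm x \<le> (\<Sum>b\<in>Basis. \<bar>x \<bullet> b\<bar>)" by (rule norm_le_l1)
      also have "\<dots> \<le> (\<Sum>b\<in>(Basis::'a set). 1)" using S(1)[OF that] by (intro sum_mono) auto
      finally show ?thesis by (simp add: d_def)
    qed
    then show ?thesis by (auto simp: bounded_iff)
  qed
  have bG: "bounded (graph_on S f)"
    unfolding graph_on_def by (rule bounded_subset[OF bounded_Times[OF bS bf]]) auto
  have bound: "real (mesh_count \<delta> (graph_on S f)) \<le> C * \<delta> powr (- (DIM('a) + 1 - s))"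
    if \<delta>: "0 < \<delta>" "\<delta> \<le> 1" for \<delta>
  proof -
    have col: "real (mesh_count \<delta> (f ` (Q \<inter> S))) \<le> (2 * L * d powr s + 2) * \<delta> powr (s - 1)"
      if Q_mem: "Q \<in> mesh_cubes \<delta> S" for Q
    proof -
      obtain k x0 where Q: "Q = mesh_cube \<delta> k" and x0: "x0 \<in> Q" "x0 \<in> S"
        using Q_mem by (auto simp: mesh_cubes_def)
      \<comment> \<open>Two points of one cube differ by at most \<open>\<delta>\<close> in each
        coordinate, so the 1-norm puts them within \<open>d * \<delta>\<close> of each
        other.\<close>
      define M where "M = L * (d * \<delta>) powr s"
      have M: "M \<ge> 0" using L by (simp add: M_def)
      have "\<bar>f x - f x0\<bar> \<le> M" if x: "x \<in> Q" "x \<in> S" for x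
      proof (cases "x = x0")
        case False
        have "norm (x - x0) \<le> (\<Sum>b\<in>Basis. \<bar>(x - x0) \<bullet> b\<bar>)" by (rule norm_le_l1)
        also have "\<dots> \<le> (\<Sum>b\<in>(Basis::'a set). \<delta>)"
        proof (rule sum_mono)
          fix b :: 'a assume "b \<in> Basis"
          then have "x \<bullet> b \<in> {of_int (k b) * \<delta>..of_int (k b) * \<delta> + \<delta>}"
            "x0 \<bullet> b \<in> {of_int (k b) * \<delta>..of_int (k b) * \<delta> + \<delta>}"
            using x(1) x0(1) by (auto simp: Q mesh_cube_def algebra_simps)
          then show "\<bar>(x - x0) \<bullet> b\<bar> \<le> \<delta>" by (auto simp: inner_diff_left)
        qed
        finally have "norm (x - x0) powr s \<le> (d * \<delta>) powr s"
          using s by (intro powr_mono2) (auto simp: d_def)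
        then show ?thesis using f[OF x(2) x0(2) False] L unfolding M_def
          by (meson mult_left_mono order.trans)
      qed (use M in simp)
      then have "f x0 - M \<le> f x \<and> f x \<le> (f x0 - M) + 2 * M" if "x \<in> Q \<inter> S" for x
        using that by (smt (verit) Int_iff)
      then have "real (mesh_count \<delta> (f ` (Q \<inter> S))) \<le> (2 * M / \<delta> + 2) ^ DIM(real)"
        using M \<delta> by (intro mesh_cubes_card_le(2)[where a = "\<lambda>_. f x0 - M"]) auto
      also have "\<dots> = 2 * L * d powr s * (\<delta> powr s / \<delta> powr 1) + 2"
        using d \<delta> by (simp add: M_def powr_mult)
      also have "\<delta> powr s / \<delta> powr 1 = \<delta> powr (s - 1)" by (rule powr_diff[symmetric])
      \<comment> \<open>Since \<open>s \<le> 1\<close> and \<open>\<delta> \<le> 1\<close>, the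
        power \<open>\<delta> powr (s - 1)\<close> is at least 1 and absorbs the additive 2.\<close>
      also have "2 * L * d powr s * \<delta> powr (s - 1) + 2 \<le> 2 * L * d powr s * \<delta> powr (s - 1) + 2 * \<delta> powr (s - 1)"
        using powr_mono_both'[of "s - 1" 0 \<delta> \<delta>] powr_le1[of "1 - s" \<delta>] s \<delta>
        by (simp add: powr_minus_divide powr_diff field_simps)
      finally show ?thesis by (simp add: algebra_simps)
    qed
    have "real (mesh_count \<delta> (graph_on S f)) = (\<Sum>Q\<in>mesh_cubes \<delta> S. real (mesh_count \<delta> (f ` (Q \<inter> S))))"
      by (simp add: mesh_count_graph_on[OF \<delta>(1) bS bf])
    also have "\<dots> \<le> (\<Sum>Q\<in>mesh_cubes \<delta> S. (2 * L * d powr s + 2) * \<delta> powr (s - 1))"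
      by (intro sum_mono col)
    also have "\<dots> = real (mesh_count \<delta> S) * ((2 * L * d powr s + 2) * \<delta> powr (s - 1))"
      by (simp add: mesh_count_eq)
    also have "\<dots> \<le> (3 / \<delta>) ^ DIM('a) * ((2 * L * d powr s + 2) * \<delta> powr (s - 1))"
      using L by (intro mult_right_mono mesh_count_unit_box S \<delta>) auto
    also have "\<dots> = C * (\<delta> powr (- d) * \<delta> powr (s - 1))"
      using \<delta> by (simp add: C_def d_def power_divide powr_minus_divide powr_realpow)
    also have "\<delta> powr (- d) * \<delta> powr (s - 1) = \<delta> powr (- (DIM('a) + 1 - s))"
      by (simp add: d_def algebra_simps flip: powr_add)
    finally show ?thesis .
  qed
  have "\<forall>\<^sub>F \<delta>::real in at_right 0. 0 < \<delta> \<and> \<delta> \<le> 1"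
    by (auto simp: eventually_at_right_field intro: exI[of _ 1])
  then have "\<forall>\<^sub>F \<delta> in at_right 0. real (mesh_count \<delta> (graph_on S f)) \<le> C * \<delta> powr (- (DIM('a) + 1 - s))"
    by eventually_elim (use bound in auto)
  then show ?thesis using bG S(2) by (intro upper_box_dim_le) (auto simp: graph_on_def)
qed

section \<open>Second differences and mesh counts of graphs\<close>

text \<open>It vanishes when \<open>h\<close> is affine on the dyadic interval, which a first
  difference does not; this is what hides the coarser summands of the Takagi series.\<close>

definition second_diff :: "(real \<Rightarrow> real) \<Rightarrow> nat \<Rightarrow> nat \<Rightarrow> real" where
  "second_diff h n i = h (real i / 2 ^ n) + h ((real i + 1) / 2 ^ n) - 2 * h ((real i + 1 / 2) / 2 ^ n)"

lemma convex_mesh_cube: "convex (mesh_cube \<delta> (k :: 'a::euclidean_space \<Rightarrow> int))"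
proof -
  have "mesh_cube \<delta> k = (\<Inter>b\<in>Basis. {x. b \<bullet> x \<ge> of_int (k b) * \<delta>} \<inter> {x. b \<bullet> x \<le> (of_int (k b) + 1) * \<delta>})"
    by (auto simp: mesh_cube_def inner_commute)
  moreover have "convex \<dots>"
    by (intro convex_INT convex_Int convex_halfspace_le convex_halfspace_ge)
  ultimately show ?thesis by simp
qed

text \<open>The second difference is bounded by the sum of two increments of \<open>f\<close> from
  \<open>y j\<close>, so one of them is at least half of it. By convexity the column is connected,
  so it contains that increment divided by \<open>\<delta>\<close> many cubes. Distinct
  \<open>j\<close> have distinct columns.\<close>

lemma mesh_count_graph_ge:
  fixes S :: "'a::euclidean_space set" and f :: "'a \<Rightarrow> real"
  assumes \<delta>: "\<delta> > 0" and S: "compact S" "convex S" and f: "continuous_on S f"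
    and J: "inj_on c J" "c ` J \<subseteq> range (mesh_cube \<delta>)"
    and pts: "\<And>j. j \<in> J \<Longrightarrow> x j \<in> c j \<inter> S \<and> y j \<in> c j \<inter> S \<and> z j \<in> c j \<inter> S"
  shows "(\<Sum>j\<in>J. \<bar>f (x j) + f (z j) - 2 * f (y j)\<bar>) / (2 * \<delta>) \<le> real (mesh_count \<delta> (graph_on S f))"
proof -
  have bS: "bounded S" and bf: "bounded (f ` S)"
    using S f compact_continuous_image compact_imp_bounded by blast+
  have col: "\<bar>f (x j) + f (z j) - 2 * f (y j)\<bar> / (2 * \<delta>) \<le> real (mesh_count \<delta> (f ` (c j \<inter> S)))"
    if j: "j \<in> J" for j
  proof -
    obtain k where k: "c j = mesh_cube \<delta> k" using J(2) j by blast
    have "connected (c j \<inter> S)"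
      unfolding k by (intro convex_connected convex_Int convex_mesh_cube S)
    then have con: "connected (f ` (c j \<inter> S))"
      by (intro connected_continuous_image continuous_on_subset[OF f]) auto
    have bd: "bounded (f ` (c j \<inter> S))" using bf by (rule bounded_subset) auto
    have "\<bar>f (x j) - f (y j)\<bar> / \<delta> \<le> real (mesh_count \<delta> (f ` (c j \<inter> S)))"
      "\<bar>f (z j) - f (y j)\<bar> / \<delta> \<le> real (mesh_count \<delta> (f ` (c j \<inter> S)))"
      using pts[OF j] by (intro mesh_count_interval_ge[OF \<delta> con bd] imageI; simp)+
    moreover have "\<bar>f (x j) + f (z j) - 2 * f (y j)\<bar> \<le> \<bar>f (x j) - f (y j)\<bar> + \<bar>f (z j) - f (y j)\<bar>"
      by linarith
    ultimately show ?thesis using \<delta> by (simp add: field_simps)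
  qed
  have sub: "c ` J \<subseteq> mesh_cubes \<delta> S" using J(2) pts by (fastforce simp: mesh_cubes_def)
  have "(\<Sum>j\<in>J. \<bar>f (x j) + f (z j) - 2 * f (y j)\<bar>) / (2 * \<delta>)
      \<le> (\<Sum>j\<in>J. real (mesh_count \<delta> (f ` (c j \<inter> S))))"
    unfolding sum_divide_distrib by (intro sum_mono col)
  also have "\<dots> = (\<Sum>Q\<in>c ` J. real (mesh_count \<delta> (f ` (Q \<inter> S))))"
    using J(1) by (simp add: sum.reindex)
  also have "\<dots> \<le> (\<Sum>Q\<in>mesh_cubes \<delta> S. real (mesh_count \<delta> (f ` (Q \<inter> S))))"
    by (intro sum_mono2 sub finite_mesh_cubes bS \<delta>) auto
  finally show ?thesis by (simp add: mesh_count_graph_on[OF \<delta> bS bf])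
qed

lemma dyadic_interval:
  assumes "i < 2 ^ n"
  shows "real i / 2 ^ n \<in> {0..1}" "(real i + 1) / 2 ^ n \<in> {0..1}" "(real i + 1 / 2) / 2 ^ n \<in> {0..1}"
proof -
  have "real (i + 1) \<le> real (2 ^ n)" using assms by (intro of_nat_mono) simp
  then have "real i + 1 \<le> 2 ^ n" by simp
  then show "real i / 2 ^ n \<in> {0..1}" "(real i + 1) / 2 ^ n \<in> {0..1}" "(real i + 1 / 2) / 2 ^ n \<in> {0..1}"
    using less_imp_le[OF assms] unfolding atLeastAtMost_iff by (simp_all add: pos_divide_le_eq)
qed

lemma mesh_count_graph_ge_interval:
  assumes h: "continuous_on {0..1} h"
  shows "2 ^ n / 2 * (\<Sum>i<2 ^ n. \<bar>second_diff h n i\<bar>) \<le> real (mesh_count (1 / 2 ^ n) (graph_on {0..1} h))"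
proof -
  define \<delta> where "\<delta> = 1 / (2 ^ n :: real)"
  define c where "c i = (mesh_cube \<delta> (\<lambda>_. int i) :: real set)" for i :: nat
  have c: "c i = {real i * \<delta>..(real i + 1) * \<delta>}" for i by (auto simp: c_def mesh_cube_def algebra_simps)
  have \<delta>: "\<delta> > 0" by (simp add: \<delta>_def)
  have "(\<Sum>i<2 ^ n. \<bar>h (real i / 2 ^ n) + h ((real i + 1) / 2 ^ n) - 2 * h ((real i + 1 / 2) / 2 ^ n)\<bar>) / (2 * \<delta>)
      \<le> real (mesh_count \<delta> (graph_on {0..1} h))"
  proof (rule mesh_count_graph_ge[OF \<delta> _ _ h, where c = c])
    show "inj_on c {..<2 ^ n}" using \<delta> by (auto simp: inj_on_def c Icc_eq_Icc mult_le_cancel_right)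
    show "c ` {..<2 ^ n} \<subseteq> range (mesh_cube \<delta>)" unfolding c_def by blast
    fix i :: nat assume "i \<in> {..<2 ^ n}"
    then have "i < 2 ^ n" by simp
    note d = dyadic_interval[OF this]
    show "real i / 2 ^ n \<in> c i \<inter> {0..1} \<and> (real i + 1 / 2) / 2 ^ n \<in> c i \<inter> {0..1} \<and> (real i + 1) / 2 ^ n \<in> c i \<inter> {0..1}"
      using d unfolding c \<delta>_def by (auto simp: field_simps)
  qed auto
  then show ?thesis by (simp add: \<delta>_def second_diff_def mult.commute)
qed

text \<open>Each mesh square is tested along its lower edge, in the \<open>x\<close>-direction only,
  because the probe varies in that direction.\<close>

lemma mesh_count_graph_ge_square:
  assumes f: "continuous_on unit_square f"
  shows "2 ^ n / 2 * (\<Sum>(i, j)\<in>{..<2 ^ n} \<times> {..<2 ^ n}. \<bar>second_diff (\<lambda>x. f (x, real j / 2 ^ n)) n i\<bar>)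
    \<le> real (mesh_count (1 / 2 ^ n) (graph_on unit_square f))"
proof -
  define \<delta> where "\<delta> = 1 / (2 ^ n :: real)"
  define c where "c i = (mesh_cube \<delta> (\<lambda>_. int i) :: real set)" for i :: nat
  have c: "c i = {real i * \<delta>..(real i + 1) * \<delta>}" for i by (auto simp: c_def mesh_cube_def algebra_simps)
  have \<delta>: "\<delta> > 0" by (simp add: \<delta>_def)
  have ne: "c i \<noteq> {}" for i unfolding c_def using mesh_cube_nonempty[OF \<delta>] .
  have inj: "inj c" using \<delta> by (auto simp: inj_on_def c Icc_eq_Icc mult_le_cancel_right)
  let ?J = "{..<2 ^ n} \<times> {..<2 ^ n} :: (nat \<times> nat) set"
  let ?x = "\<lambda>p. (real (fst p) / 2 ^ n, real (snd p) / 2 ^ n) :: real \<times> real"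
  let ?y = "\<lambda>p. ((real (fst p) + 1 / 2) / 2 ^ n, real (snd p) / 2 ^ n) :: real \<times> real"
  let ?z = "\<lambda>p. ((real (fst p) + 1) / 2 ^ n, real (snd p) / 2 ^ n) :: real \<times> real"
  let ?c = "\<lambda>p. c (fst p) \<times> c (snd p)"
  have "(\<Sum>p\<in>?J. \<bar>f (?x p) + f (?z p) - 2 * f (?y p)\<bar>) / (2 * \<delta>) \<le> real (mesh_count \<delta> (graph_on unit_square f))"
  proof (rule mesh_count_graph_ge[OF \<delta> _ _ f, where c = ?c])
    show "inj_on ?c ?J" using ne inj by (auto simp: inj_on_def times_eq_iff)
    show "?c ` ?J \<subseteq> range (mesh_cube \<delta>)" unfolding range_mesh_cube_prod c_def by auto
    fix p assume "p \<in> ?J"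
    then have "fst p < 2 ^ n" "snd p < 2 ^ n" by auto
    note d = dyadic_interval[OF this(1)] dyadic_interval[OF this(2)]
    show "?x p \<in> ?c p \<inter> unit_square \<and> ?y p \<in> ?c p \<inter> unit_square \<and> ?z p \<in> ?c p \<inter> unit_square"
      using d unfolding c \<delta>_def by (auto simp: field_simps)
  qed (auto intro: compact_Times convex_Times)
  then show ?thesis by (simp add: \<delta>_def second_diff_def case_prod_unfold mult.commute)
qed

section \<open>Almost every shift has large variation\<close>

lemma summable_inverse_squares_Suc: "summable (\<lambda>k. 1 / (real k + 1)\<^sup>2)"
  using summable_Suc_iff[of "\<lambda>k. inverse (real k ^ 2)"] inverse_power_summable[of 2, where 'a = real]
  by (simp add: inverse_eq_divide add.commute)

text \<open>The index sets \<open>I n\<close> and the offsets \<open>u\<close> are arbitrary, so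
  that one statement serves both the interval and the square, whatever function is being
  shifted.\<close>

lemma AE_eventually_sum_abs_ge:
  fixes u v :: "nat \<Rightarrow> 'i \<Rightarrow> real"
  shows "AE t in lborel. \<forall>\<^sub>F n in sequentially.
    (\<Sum>i\<in>I n. \<bar>v n i\<bar>) / (real n + 1)\<^sup>2 \<le> (\<Sum>i\<in>I n. \<bar>u n i + t * v n i\<bar>)"
proof -
  define V where "V n = (\<Sum>i\<in>I n. \<bar>v n i\<bar>)" for n
  define G where "G n t = (\<Sum>i\<in>I n. \<bar>u n i + t * v n i\<bar>)" for n t
  define A where "A n = {t. G n t < V n / (real n + 1)\<^sup>2}" for n
  define \<epsilon> where "\<epsilon> n = 1 / (real n + 1)\<^sup>2" for n
  have cont: "continuous_on UNIV (G n)" for n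
    unfolding G_def by (intro continuous_intros)
  have "open (A n)" for n
    unfolding A_def using cont by (intro open_Collect_less) (auto intro: continuous_intros)
  then have meas: "A n \<in> sets lborel" for n by auto
  have small: "emeasure lborel (A n) \<le> ennreal (4 * \<epsilon> n)" for n
  proof (cases "A n = {}")
    case False
    then obtain t0 where t0: "t0 \<in> A n" by blast
    \<comment> \<open>The inequality defining \<open>A n\<close> is strict, so a bad shift can exist
      only when \<open>V n\<close> is positive; this allows dividing by it below.\<close>
    have V: "V n > 0"
    proof -
      have "0 \<le> G n t0" unfolding G_def by (intro sum_nonneg) auto
      then have "0 < V n / (real n + 1)\<^sup>2" using t0 by (simp add: A_def)
      then show ?thesis by (simp add: zero_less_divide_iff)
    qed
    \<comment> \<open>Any single bad shift \<open>t0\<close> can serve as the centre: by the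
      triangle inequality, two shifts with small sums are close together.\<close>
    have "A n \<subseteq> {t0 - 2 * \<epsilon> n..t0 + 2 * \<epsilon> n}"
    proof
      fix t assume t: "t \<in> A n"
      have "\<bar>t - t0\<bar> * V n \<le> G n t + G n t0"
        unfolding V_def G_def sum_distrib_left sum.distrib[symmetric]
        by (intro sum_mono) (simp add: abs_mult[symmetric] left_diff_distrib)
      also have "\<dots> \<le> 2 * \<epsilon> n * V n" using t t0 by (simp add: A_def \<epsilon>_def add.commute)
      finally have "\<bar>t - t0\<bar> \<le> 2 * \<epsilon> n" using V by simp
      then show "t \<in> {t0 - 2 * \<epsilon> n..t0 + 2 * \<epsilon> n}" by auto
    qed
    then have "emeasure lborel (A n) \<le> emeasure lborel {t0 - 2 * \<epsilon> n..t0 + 2 * \<epsilon> n}"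
      by (intro emeasure_mono) auto
    also have "\<dots> = ennreal (4 * \<epsilon> n)" by (simp add: \<epsilon>_def)
    finally show ?thesis .
  qed simp
  have summ: "summable (\<lambda>n. 4 * \<epsilon> n)"
    unfolding \<epsilon>_def by (intro summable_mult summable_inverse_squares_Suc)
  have "AE t in lborel. \<forall>\<^sub>F n in sequentially. t \<in> space lborel - A n"
  proof (rule borel_cantelli_AE1[OF meas])
    show "emeasure lborel (A n) < \<infinity>" for n using small[of n] by (simp add: le_less_trans)
    have "measure lborel (A n) \<le> 4 * \<epsilon> n" for n
      using small[of n] by (simp add: measure_def \<epsilon>_def enn2real_leI)
    then show "summable (\<lambda>n. measure lborel (A n))"
      by (intro summable_comparison_test'[OF summ]) auto
  qed
  then show ?thesis
    by (rule AE_mp, intro AE_I2 impI) (auto simp: A_def V_def G_def not_less elim: eventually_mono)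
qed

section \<open>A Takagi function\<close>

definition tri :: "real \<Rightarrow> real" where "tri x = \<bar>x - of_int (round x)\<bar>"

lemma tri_le: "tri x \<le> \<bar>x - of_int m\<bar>"
  unfolding tri_def by (rule round_diff_minimal)

lemma tri_bounds: "0 \<le> tri x" "tri x \<le> 1 / 2"
  using of_int_round_abs_le[of x] by (auto simp: tri_def abs_minus_commute)

lemma tri_diff_le: "\<bar>tri x - tri y\<bar> \<le> \<bar>x - y\<bar>"
  using tri_le[of x "round y"] tri_le[of y "round x"] unfolding tri_def by linarith

text \<open>On the interval from \<open>m / 2\<close> to \<open>(m + 1) / 2\<close> the function is
  affine, with slope 1 for even \<open>m\<close> and -1 for odd \<open>m\<close>. The names of this
  lemma and the next refer to that parity.\<close>

lemma tri_even: "of_int q \<le> x \<Longrightarrow> x \<le> of_int q + 1 / 2 \<Longrightarrow> tri x = x - of_int q"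
proof (rule antisym)
  assume x: "of_int q \<le> x" "x \<le> of_int q + 1 / 2"
  show "tri x \<le> x - of_int q" using tri_le[of x q] x by simp
  have "round x \<le> q \<or> round x \<ge> q + 1" by linarith
  then have "real_of_int (round x) \<le> of_int q \<or> real_of_int (round x) \<ge> of_int q + 1" by linarith
  then show "x - of_int q \<le> tri x" using x unfolding tri_def by linarith
qed

lemma tri_odd: "of_int q + 1 / 2 \<le> x \<Longrightarrow> x \<le> of_int q + 1 \<Longrightarrow> tri x = of_int q + 1 - x"
proof (rule antisym)
  assume x: "of_int q + 1 / 2 \<le> x" "x \<le> of_int q + 1"
  show "tri x \<le> of_int q + 1 - x" using tri_le[of x "q + 1"] x by simp
  have "round x \<le> q \<or> round x \<ge> q + 1" by linarith
  then have "real_of_int (round x) \<le> of_int q \<or> real_of_int (round x) \<ge> of_int q + 1" by linarith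
  then show "of_int q + 1 - x \<le> tri x" using x unfolding tri_def by linarith
qed

lemma tri_int [simp]: "tri (of_int m) = 0" "tri (of_nat n) = 0"
  by (simp_all add: tri_def)

text \<open>For \<open>k = n\<close> the midpoint hits the peak 1/2 and both ends hit zeros. For
  \<open>k > n\<close> all three points are scaled to integers. For \<open>k < n\<close> they fall
  into one affine piece.\<close>

lemma second_diff_tri:
  "second_diff (\<lambda>x. tri (2 ^ k * x)) n i = (if k = n then - 1 else 0)"
proof (cases k n rule: linorder_cases)
  case equal
  have "tri (real i + 1 / 2) = 1 / 2" using tri_even[of "int i" "real i + 1 / 2"] by simp
  moreover have "tri (real i + 1) = 0" using tri_int(2)[of "Suc i"] by (simp add: add.commute)
  ultimately show ?thesis using equal by (simp add: second_diff_def)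
next
  case greater
  then obtain p where p: "k = n + Suc p" using less_imp_Suc_add by auto
  have "tri (2 ^ k * (real i / 2 ^ n)) = tri (of_nat (2 ^ Suc p * i))"
    "tri (2 ^ k * ((real i + 1) / 2 ^ n)) = tri (of_nat (2 ^ Suc p * (i + 1)))"
    "tri (2 ^ k * ((real i + 1 / 2) / 2 ^ n)) = tri (of_nat (2 ^ p * (2 * i + 1)))"
    by (rule arg_cong[where f = tri], simp add: p power_add field_simps)+
  then show ?thesis using greater unfolding second_diff_def tri_int by simp
next
  case less
  then obtain p where p: "n = k + Suc p" using less_imp_Suc_add by auto
  define l where "l = real i / 2 ^ Suc p"
  define w where "w = 1 / (2 ^ Suc p :: real)"
  have pts: "2 ^ k * (i / 2 ^ n) = l" "2 ^ k * ((real i + 1) / 2 ^ n) = l + w" "2 ^ k * ((real i + 1 / 2) / 2 ^ n) = l + w / 2"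
    by (simp_all add: p l_def w_def power_add field_simps)
  have w: "w > 0" by (simp add: w_def)
  \<comment> \<open>\<open>m / 2\<close> is the largest half-integer multiple not exceeding
    \<open>l\<close>. The remainder satisfies \<open>r + 1 \<le> 2 ^ p\<close>, which keeps the
    right end \<open>l + w\<close> within the same affine piece.\<close>
  define m where "m = i div 2 ^ p"
  define r where "r = i mod 2 ^ p"
  have i: "i = m * 2 ^ p + r" unfolding m_def r_def by (rule div_mult_mod_eq[symmetric])
  have "r + 1 \<le> 2 ^ p" by (simp add: r_def Suc_leI)
  then have "real (r + 1) \<le> real (2 ^ p)" by (rule of_nat_mono)
  then have "real i = m * 2 ^ p + real r" "real r + 1 \<le> 2 ^ p" by (simp_all add: i)
  then have lw: "m / 2 \<le> l" "l + w \<le> (m + 1) / 2"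
    by (simp_all add: l_def w_def field_simps)
  have "tri l + tri (l + w) - 2 * tri (l + w / 2) = 0"
  proof (cases "even m")
    case True
    then obtain q where "m = 2 * q" by blast
    then have "of_int (int q) \<le> l" "l + w \<le> of_int (int q) + 1 / 2" using lw by auto
    then show ?thesis using w by (simp add: tri_even[of "int q"])
  next
    case False
    then obtain q where "m = 2 * q + 1" using oddE by blast
    then have "of_int (int q) + 1 / 2 \<le> l" "l + w \<le> of_int (int q) + 1" using lw by (auto simp: field_simps)
    then show ?thesis using w by (simp add: tri_odd[of "int q"])
  qed
  then show ?thesis using less unfolding second_diff_def pts by simp
qed

section \<open>The weighted Takagi series\<close>

definition takagi :: "real \<Rightarrow> real \<Rightarrow> real" where
  "takagi s x = (\<Sum>k. 1 / (real k + 1)\<^sup>2 * 2 powr (- (real k * s)) * tri (2 ^ k * x))"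

lemma takagi_term_le:
  assumes "0 \<le> s"
  shows "norm (1 / (real k + 1)\<^sup>2 * 2 powr (- (real k * s)) * tri (2 ^ k * x)) \<le> 1 / (real k + 1)\<^sup>2"
proof -
  have "2 powr (- (real k * s)) \<le> 2 powr 0" using assms by (intro powr_mono) auto
  then have "2 powr (- (real k * s)) * tri (2 ^ k * x) \<le> 1 * 1"
    using tri_bounds[of "2 ^ k * x"] by (intro mult_mono) auto
  then show ?thesis
    using tri_bounds(1)[of "2 ^ k * x"] by (simp add: abs_mult divide_le_cancel)
qed

lemma takagi_sums:
  assumes "0 \<le> s"
  shows "(\<lambda>k. 1 / (real k + 1)\<^sup>2 * 2 powr (- (real k * s)) * tri (2 ^ k * x)) sums takagi s x"
  unfolding takagi_def
proof (rule summable_sums, rule summable_comparison_test'[OF summable_inverse_squares_Suc])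
  show "norm (1 / (real k + 1)\<^sup>2 * 2 powr (- (real k * s)) * tri (2 ^ k * x)) \<le> 1 / (real k + 1)\<^sup>2" for k
    by (rule takagi_term_le[OF assms])
qed

text \<open>Second differences act termwise on the convergent series and leave only its
  \<open>n\<close>-th coefficient. The value does not depend on \<open>i\<close>, so the sums over
  dyadic intervals become explicit.\<close>

lemma second_diff_takagi:
  assumes "0 \<le> s"
  shows "second_diff (takagi s) n i = - (2 powr (- (real n * s)) / (real n + 1)\<^sup>2)"
proof -
  define a where "a k = 1 / (real k + 1)\<^sup>2 * 2 powr (- (real k * s))" for k
  define T where "T k x = tri (2 ^ k * x)" for k :: nat and x
  have su: "(\<lambda>k. a k * T k x) sums takagi s x" for x
    unfolding a_def T_def by (rule takagi_sums[OF assms])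
  have "(\<lambda>k. a k * T k x + a k * T k z - 2 * (a k * T k y)) sums (takagi s x + takagi s z - 2 * takagi s y)"
    for x y z
    using sums_diff[OF sums_add[OF su[of x] su[of z]] sums_mult[OF su[of y], of 2]] .
  moreover have "a k * p + a k * q - 2 * (a k * r) = a k * (p + q - 2 * r)" for k p q r
    by (simp add: algebra_simps)
  ultimately have "(\<lambda>k. a k * second_diff (T k) n i) sums second_diff (takagi s) n i"
    unfolding second_diff_def by (simp only:)
  moreover have "second_diff (T k) n i = (if k = n then - 1 else 0)" for k
    unfolding T_def by (rule second_diff_tri)
  ultimately have "(\<lambda>k. if k = n then - a k else 0) sums second_diff (takagi s) n i"
    by (simp add: if_distrib[of "(*) (a _)"] cong: if_cong)
  then have "second_diff (takagi s) n i = - a n"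
    using sums_single[of n "\<lambda>k. - a k"] by (rule sums_unique2)
  then show ?thesis by (simp add: a_def)
qed

text \<open>With \<open>e = 2 ^ k * \<bar>x - y\<bar>\<close>, the \<open>k\<close>-th increment of
  \<open>tri\<close> is at most both \<open>e\<close> and 1, hence at most \<open>e powr s\<close>.
  The factor \<open>2 powr (k * s)\<close> then cancels against the coefficient and leaves a
  summable weight.\<close>

lemma takagi_Hoelder:
  assumes s: "0 \<le> s" "s \<le> 1" and "x \<noteq> y"
  shows "\<bar>takagi s x - takagi s y\<bar> \<le> (\<Sum>k. 1 / (real k + 1)\<^sup>2) * \<bar>x - y\<bar> powr s"
proof -
  define h where "h = \<bar>x - y\<bar>"
  define a where "a k = 1 / (real k + 1)\<^sup>2 * 2 powr (- (real k * s))" for k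
  have h: "h > 0" using assms by (simp add: h_def)
  have su: "(\<lambda>k. a k * tri (2 ^ k * x)) sums takagi s x" for x
    unfolding a_def by (rule takagi_sums[OF s(1)])
  have S: "(\<lambda>k. a k * tri (2 ^ k * x) - a k * tri (2 ^ k * y)) sums (takagi s x - takagi s y)"
    by (intro sums_diff su)
  have B: "summable (\<lambda>k. 1 / (real k + 1)\<^sup>2 * h powr s)"
    by (intro summable_mult2 summable_inverse_squares_Suc)
  have le: "norm (a k * tri (2 ^ k * x) - a k * tri (2 ^ k * y)) \<le> 1 / (real k + 1)\<^sup>2 * h powr s" for k
  proof -
    define e where "e = 2 ^ k * h"
    have e: "e > 0" using h by (simp add: e_def)
    have "\<bar>tri (2 ^ k * x) - tri (2 ^ k * y)\<bar> \<le> \<bar>2 ^ k * x - 2 ^ k * y\<bar>" by (rule tri_diff_le)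
    also have "\<dots> = e" by (simp add: e_def h_def abs_mult flip: right_diff_distrib)
    finally have "\<bar>tri (2 ^ k * x) - tri (2 ^ k * y)\<bar> \<le> e" .
    moreover have "\<bar>tri (2 ^ k * x) - tri (2 ^ k * y)\<bar> \<le> 1"
      using tri_bounds[of "2 ^ k * x"] tri_bounds[of "2 ^ k * y"] by linarith
    \<comment> \<open>The case \<open>e \<le> 1\<close> rests on \<open>s \<le> 1\<close>, the other
      on \<open>s \<ge> 0\<close>.\<close>
    moreover have "e \<le> e powr s \<or> 1 \<le> e powr s"
    proof (cases "e \<le> 1")
      case True
      then show ?thesis using powr_mono'[of s 1 e] s e by simp
    qed (use s in \<open>simp add: ge_one_powr_ge_zero\<close>)
    ultimately have tri_le_powr: "\<bar>tri (2 ^ k * x) - tri (2 ^ k * y)\<bar> \<le> e powr s" by linarith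
    have two_pow: "(2::real) ^ k = 2 powr real k" by (simp add: powr_realpow)
    have "e powr s = 2 powr (real k * s) * h powr s"
      using h by (simp only: e_def powr_mult powr_powr two_pow)
    with tri_le_powr have "a k * \<bar>tri (2 ^ k * x) - tri (2 ^ k * y)\<bar> \<le> a k * (2 powr (real k * s) * h powr s)"
      by (intro mult_left_mono) (auto simp: a_def)
    also have "\<dots> = 1 / (real k + 1)\<^sup>2 * h powr s" by (simp add: a_def powr_minus)
    finally have "a k * \<bar>tri (2 ^ k * x) - tri (2 ^ k * y)\<bar> \<le> 1 / (real k + 1)\<^sup>2 * h powr s" .
    moreover have "a k \<ge> 0" by (simp add: a_def)
    ultimately show ?thesis
      unfolding right_diff_distrib[symmetric] real_norm_def abs_mult by simp
  qed
  have "norm (\<Sum>k. a k * tri (2 ^ k * x) - a k * tri (2 ^ k * y)) \<le> (\<Sum>k. 1 / (real k + 1)\<^sup>2 * h powr s)"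
    by (intro norm_suminf_le B le)
  also have "\<dots> = (\<Sum>k. 1 / (real k + 1)\<^sup>2) * h powr s"
    by (intro suminf_mult2[symmetric] summable_inverse_squares_Suc)
  finally show ?thesis using sums_unique[OF S] by (simp add: h_def)
qed

text \<open>Proved by uniform convergence, since for \<open>s = 0\<close> the Hoelder bound does not
  give continuity.\<close>

lemma continuous_on_takagi:
  assumes "0 \<le> s"
  shows "continuous_on A (takagi s)"
proof -
  have tri_cont: "continuous_on UNIV tri"
    unfolding continuous_on_iff dist_real_def
  proof (intro ballI allI impI)
    fix x e :: real assume "e > 0"
    have "\<bar>tri y - tri x\<bar> < e" if "\<bar>y - x\<bar> < e" for y
      using tri_diff_le[of y x] that by linarith
    then show "\<exists>d>0. \<forall>y\<in>UNIV. \<bar>y - x\<bar> < d \<longrightarrow> \<bar>tri y - tri x\<bar> < e"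
      using \<open>e > 0\<close> by blast
  qed
  have tri_mult: "continuous_on A (\<lambda>x. tri (2 ^ k * x))" for k
    by (rule continuous_on_compose2[OF tri_cont]) (auto intro!: continuous_intros)
  have lim: "uniform_limit A (\<lambda>n x. \<Sum>k<n. 1 / (real k + 1)\<^sup>2 * 2 powr (- (real k * s)) * tri (2 ^ k * x))
      (takagi s) sequentially"
    unfolding takagi_def[abs_def]
  proof (rule Weierstrass_m_test[OF _ summable_inverse_squares_Suc])
    show "norm (1 / (real k + 1)\<^sup>2 * 2 powr (- (real k * s)) * tri (2 ^ k * x)) \<le> 1 / (real k + 1)\<^sup>2" for k x
      by (rule takagi_term_le[OF assms])
  qed
  have "\<forall>\<^sub>F n in sequentially.
      continuous_on A (\<lambda>x. \<Sum>k<n. 1 / (real k + 1)\<^sup>2 * 2 powr (- (real k * s)) * tri (2 ^ k * x))"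
    by (intro always_eventually allI continuous_intros tri_mult)
  then show ?thesis by (rule uniform_limit_theorem[OF _ lim]) simp
qed

section \<open>Lower box dimension along the probe\<close>

lemma bounded_graph_on:
  fixes S :: "'a::euclidean_space set"
  assumes "compact S" "continuous_on S f"
  shows "bounded (graph_on S f)" "compact (graph_on S f)"
proof -
  show "compact (graph_on S f)"
    unfolding graph_on_def by (intro compact_continuous_image continuous_intros assms)
  then show "bounded (graph_on S f)" by (rule compact_imp_bounded)
qed

text \<open>A polynomial loss in \<open>n\<close> is eventually below \<open>2 powr (n * e)\<close>
  for each \<open>e > 0\<close>. In the fourth power, one square comes from the Takagi weights and
  one from the Borel--Cantelli thresholds; the 2 comes from halving second differences.\<close>

lemma lower_box_dim_geI:
  fixes F :: "'a::euclidean_space set"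
  assumes F: "bounded F" "F \<noteq> {}"
    and ge: "\<forall>\<^sub>F n in sequentially. 2 powr (real n * d) / (2 * (real n + 1) ^ 4) \<le> real (mesh_count (1 / 2 ^ n) F)"
  shows "ereal d \<le> lower_box_dim F"
  unfolding lower_box_dim_ge_iff[OF F]
proof
  fix m :: nat
  define e where "e = 1 / (real m + 1)"
  have "e > 0" by (simp add: e_def)
  then have "\<forall>\<^sub>F n in sequentially. 2 * (real n + 1) ^ 4 \<le> 2 powr (real n * e)"
    by real_asymp
  then have "\<forall>\<^sub>F n in sequentially. 2 powr (real n * (d - e)) \<le> real (mesh_count (1 / 2 ^ n) F)"
    using ge
  proof eventually_elim
    case (elim n)
    have "2 powr (real n * (d - e)) = 2 powr (real n * d) / 2 powr (real n * e)"
      by (simp add: right_diff_distrib powr_diff)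
    also have "\<dots> \<le> 2 powr (real n * d) / (2 * (real n + 1) ^ 4)"
      using elim(1) by (intro divide_left_mono) (auto intro: mult_pos_pos)
    finally show ?case using elim(2) by linarith
  qed
  then show "\<forall>\<^sub>F n in sequentially. 2 powr (real n * (d - 1 / (real m + 1))) \<le> real (mesh_count (1 / 2 ^ n) F)"
    unfolding e_def .
qed

lemma half_power_mult_powr:
  assumes "e = d + 1"
  shows "2 powr (real n * e) / (2 * (real n + 1) ^ 4)
    = 2 ^ n / 2 * (2 powr (real n * d) / (real n + 1)\<^sup>2 / (real n + 1)\<^sup>2)"
proof -
  have "2 powr (real n * e) = 2 powr real n * 2 powr (real n * d)"
    by (simp add: assms distrib_left add.commute flip: powr_add)
  moreover have "(real n + 1) ^ 4 = (real n + 1)\<^sup>2 * (real n + 1)\<^sup>2"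
    by (simp flip: power_add)
  ultimately show ?thesis by (simp add: powr_realpow)
qed

lemma second_diff_add_mult:
  "second_diff (\<lambda>x. h x + t * \<phi> x) n i = second_diff h n i + t * second_diff \<phi> n i"
  unfolding second_diff_def by (simp add: algebra_simps)

text \<open>The \<open>2 ^ n\<close> second differences of \<open>takagi s\<close> sum to
  \<open>2 powr (n * (1 - s))\<close> up to the weight, and passing to mesh counts contributes
  another factor \<open>2 ^ n\<close>.\<close>

lemma AE_lower_box_dim_interval:
  assumes s: "0 \<le> s" and h: "continuous_on {0..1} h"
  shows "AE t in lborel. ereal (2 - s) \<le> lower_box_dim (graph_on {0..1} (\<lambda>x. h x + t * takagi s x))"
proof -
  have "AE t in lborel. \<forall>\<^sub>F n in sequentially.
      (\<Sum>i\<in>{..<2 ^ n}. \<bar>second_diff (takagi s) n i\<bar>) / (real n + 1)\<^sup>2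
        \<le> (\<Sum>i\<in>{..<2 ^ n}. \<bar>second_diff h n i + t * second_diff (takagi s) n i\<bar>)"
    by (rule AE_eventually_sum_abs_ge)
  then show ?thesis
  proof eventually_elim
    case (elim t)
    have cont: "continuous_on {0..1} (\<lambda>x. h x + t * takagi s x)"
      using s by (intro continuous_intros h continuous_on_takagi)
    show ?case
    proof (rule lower_box_dim_geI)
      show "bounded (graph_on {0..1} (\<lambda>x. h x + t * takagi s x))"
        using cont by (intro bounded_graph_on) auto
      show "\<forall>\<^sub>F n in sequentially. 2 powr (real n * (2 - s)) / (2 * (real n + 1) ^ 4)
          \<le> real (mesh_count (1 / 2 ^ n) (graph_on {0..1} (\<lambda>x. h x + t * takagi s x)))"
        using elim
      proof eventually_elim
        case (elim n)
        have two_pow: "(2::real) ^ n = 2 powr real n" by (simp add: powr_realpow)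
        have "(\<Sum>i\<in>{..<2 ^ n}. \<bar>second_diff (takagi s) n i\<bar>) = 2 ^ n * (2 powr (- (real n * s)) / (real n + 1)\<^sup>2)"
          by (simp add: second_diff_takagi[OF s])
        also have "\<dots> = 2 powr (real n * (1 - s)) / (real n + 1)\<^sup>2"
          unfolding two_pow by (simp add: algebra_simps flip: powr_add)
        finally have S: "2 powr (real n * (1 - s)) / (real n + 1)\<^sup>2 / (real n + 1)\<^sup>2
            \<le> (\<Sum>i<2 ^ n. \<bar>second_diff (\<lambda>x. h x + t * takagi s x) n i\<bar>)"
          using elim by (simp only: second_diff_add_mult)
        have "2 powr (real n * (2 - s)) / (2 * (real n + 1) ^ 4)
            = 2 ^ n / 2 * (2 powr (real n * (1 - s)) / (real n + 1)\<^sup>2 / (real n + 1)\<^sup>2)"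
          by (rule half_power_mult_powr) simp
        also have "\<dots> \<le> 2 ^ n / 2 * (\<Sum>i<2 ^ n. \<bar>second_diff (\<lambda>x. h x + t * takagi s x) n i\<bar>)"
          by (intro mult_left_mono S) simp
        also have "\<dots> \<le> real (mesh_count (1 / 2 ^ n) (graph_on {0..1} (\<lambda>x. h x + t * takagi s x)))"
          by (rule mesh_count_graph_ge_interval[OF cont])
        finally show ?case .
      qed
    qed (simp add: graph_on_def)
  qed
qed

text \<open>As on the interval, but with \<open>2 ^ n\<close> rows. The shift has the same second
  differences in each row, which adds 1 to the exponent.\<close>

lemma AE_lower_box_dim_square:
  assumes s: "0 \<le> s" and f: "continuous_on unit_square f"
  shows "AE t in lborel. ereal (3 - s) \<le> lower_box_dim (graph_on unit_square (\<lambda>p. f p + t * takagi s (fst p)))"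
proof -
  have "AE t in lborel. \<forall>\<^sub>F n in sequentially.
      (\<Sum>p\<in>{..<2 ^ n} \<times> {..<2 ^ n :: nat}. \<bar>second_diff (takagi s) n (fst p)\<bar>) / (real n + 1)\<^sup>2
        \<le> (\<Sum>p\<in>{..<2 ^ n} \<times> {..<2 ^ n}.
            \<bar>second_diff (\<lambda>x. f (x, real (snd p) / 2 ^ n)) n (fst p) + t * second_diff (takagi s) n (fst p)\<bar>)"
    by (rule AE_eventually_sum_abs_ge)
  then show ?thesis
  proof eventually_elim
    case (elim t)
    let ?F = "\<lambda>p. f p + t * takagi s (fst p)"
    have cont: "continuous_on unit_square ?F"
      using s by (intro continuous_intros f continuous_on_compose2[OF continuous_on_takagi[of s UNIV]]) auto
    show ?case
    proof (rule lower_box_dim_geI)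
      show "bounded (graph_on unit_square ?F)"
        using cont by (intro bounded_graph_on compact_Times) auto
      show "\<forall>\<^sub>F n in sequentially. 2 powr (real n * (3 - s)) / (2 * (real n + 1) ^ 4)
          \<le> real (mesh_count (1 / 2 ^ n) (graph_on unit_square ?F))"
        using elim
      proof eventually_elim
        case (elim n)
        have two_pow: "(2::real) ^ n = 2 powr real n" by (simp add: powr_realpow)
        have "(\<Sum>p\<in>{..<2 ^ n} \<times> {..<2 ^ n :: nat}. \<bar>second_diff (takagi s) n (fst p)\<bar>)
            = 2 ^ n * 2 ^ n * (2 powr (- (real n * s)) / (real n + 1)\<^sup>2)"
          by (simp add: second_diff_takagi[OF s])
        also have "\<dots> = 2 powr (real n * (2 - s)) / (real n + 1)\<^sup>2"
          unfolding two_pow by (simp add: algebra_simps flip: powr_add)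
        finally have S: "2 powr (real n * (2 - s)) / (real n + 1)\<^sup>2 / (real n + 1)\<^sup>2
            \<le> (\<Sum>(i, j)\<in>{..<2 ^ n} \<times> {..<2 ^ n}. \<bar>second_diff (\<lambda>x. ?F (x, real j / 2 ^ n)) n i\<bar>)"
          using elim by (simp only: second_diff_add_mult case_prod_unfold fst_conv)
        have "2 powr (real n * (3 - s)) / (2 * (real n + 1) ^ 4)
            = 2 ^ n / 2 * (2 powr (real n * (2 - s)) / (real n + 1)\<^sup>2 / (real n + 1)\<^sup>2)"
          by (rule half_power_mult_powr) simp
        also have "\<dots> \<le> 2 ^ n / 2 * (\<Sum>(i, j)\<in>{..<2 ^ n} \<times> {..<2 ^ n}. \<bar>second_diff (\<lambda>x. ?F (x, real j / 2 ^ n)) n i\<bar>)"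
          by (intro mult_left_mono S) simp
        also have "\<dots> \<le> real (mesh_count (1 / 2 ^ n) (graph_on unit_square ?F))"
          by (rule mesh_count_graph_ge_square[OF cont])
        finally show ?case .
      qed
    qed (simp add: graph_on_def)
  qed
qed

section \<open>The horizon operator on Hoelder spaces\<close>

lemma Lip_space_cont: "f \<in> Lip_space \<alpha> \<Longrightarrow> continuous_on unit_square f"
  by (simp add: Lip_space_def cont_space_def)

lemma Lip_space_Hoelder:
  assumes "f \<in> Lip_space \<alpha>" "x \<in> unit_square" "y \<in> unit_square"
  shows "\<bar>f x - f y\<bar> \<le> Lip_norm \<alpha> f * norm (x - y) powr (3 - \<alpha>)"
proof (cases "x = y")
  case False
  then show ?thesis using Lip_le_Lip_norm[OF assms False]
    by (simp add: divide_le_eq split: if_splits)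
qed (simp add: Lip_norm_nonneg)

lemma Lip_spaceI:
  assumes "continuous_on unit_square f" "\<And>x. x \<notin> unit_square \<Longrightarrow> f x = 0" "0 \<le> L"
    and "\<And>x y. x \<in> unit_square \<Longrightarrow> y \<in> unit_square \<Longrightarrow> x \<noteq> y \<Longrightarrow> \<bar>f x - f y\<bar> \<le> L * norm (x - y) powr (3 - \<alpha>)"
  shows "f \<in> Lip_space \<alpha>"
proof -
  have "Lip \<alpha> f \<le> ennreal L"
    unfolding Lip_le_iff[OF assms(3)] using assms(4) by (auto simp: pos_divide_le_eq)
  then have "Lip \<alpha> f < \<infinity>" by (simp add: le_less_trans)
  then show ?thesis using assms(1,2) unfolding Lip_space_def cont_space_def by blast
qed

lemma abs_diff_cSUP_le:
  fixes f g :: "'a \<Rightarrow> real"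
  assumes "A \<noteq> {}" "bdd_above (f ` A)" "bdd_above (g ` A)" and le: "\<And>y. y \<in> A \<Longrightarrow> \<bar>f y - g y\<bar> \<le> e"
  shows "\<bar>(SUP y\<in>A. f y) - (SUP y\<in>A. g y)\<bar> \<le> e"
proof -
  have "(SUP y\<in>A. f y) \<le> (SUP y\<in>A. g y) + e"
    using assms(1) cSUP_upper[OF _ assms(3)] le by (intro cSUP_least) (auto simp: abs_le_iff, smt (verit))
  moreover have "(SUP y\<in>A. g y) \<le> (SUP y\<in>A. f y) + e"
    using assms(1) cSUP_upper[OF _ assms(2)] le by (intro cSUP_least) (auto simp: abs_le_iff, smt (verit))
  ultimately show ?thesis by linarith
qed

lemma bdd_above_slice:
  fixes f :: "real \<times> real \<Rightarrow> real"
  assumes "continuous_on unit_square f" "x \<in> {0..1}"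
  shows "bdd_above ((\<lambda>y. f (x, y)) ` {0..1})"
proof -
  have "continuous_on {0..1} (\<lambda>y. f (x, y))"
    by (rule continuous_on_compose2[OF assms(1)]) (use assms(2) in \<open>auto intro!: continuous_intros\<close>)
  from compact_imp_bounded[OF compact_continuous_image[OF this compact_Icc]] show ?thesis
    by (rule bounded_imp_bdd_above)
qed

text \<open>Two functions and two points are allowed at once: \<open>g = f\<close> yields continuity
  and the Hoelder bound of the horizon, \<open>x' = x\<close> its Lipschitz dependence on the
  function.\<close>

lemma horizon_diff_le:
  assumes "continuous_on unit_square f" "continuous_on unit_square g" "x \<in> {0..1}" "x' \<in> {0..1}"
    and "\<And>y. y \<in> {0..1} \<Longrightarrow> \<bar>f (x, y) - g (x', y)\<bar> \<le> e"
  shows "\<bar>horizon f x - horizon g x'\<bar> \<le> e"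
proof -
  have "\<bar>(SUP y\<in>{0..1}. f (x, y)) - (SUP y\<in>{0..1}. g (x', y))\<bar> \<le> e"
    by (rule abs_diff_cSUP_le[OF _ bdd_above_slice[OF assms(1,3)] bdd_above_slice[OF assms(2,4)] assms(5)]) auto
  then show ?thesis using assms(3,4) by (simp add: horizon_def)
qed

lemma continuous_on_horizon:
  assumes "continuous_on unit_square f"
  shows "continuous_on {0..1} (horizon f)"
  unfolding continuous_on_iff
proof (intro ballI allI impI)
  fix x e :: real assume x: "x \<in> {0..1}" and e: "e > 0"
  \<comment> \<open>Uniformity supplies one \<open>d\<close> for all \<open>y\<close>, so the
    estimate survives the supremum.\<close>
  have "uniformly_continuous_on unit_square f"
    using assms by (intro compact_uniformly_continuous compact_Times) auto
  then obtain d where d: "d > 0"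
    "\<And>p q. p \<in> unit_square \<Longrightarrow> q \<in> unit_square \<Longrightarrow> dist q p < d \<Longrightarrow> dist (f q) (f p) < e / 2"
    unfolding uniformly_continuous_on_def using e by (metis half_gt_zero)
  show "\<exists>d>0. \<forall>x'\<in>{0..1}. dist x' x < d \<longrightarrow> dist (horizon f x') (horizon f x) < e"
  proof (intro exI[of _ d] conjI ballI impI d)
    fix x' :: real assume x': "x' \<in> {0..1}" "dist x' x < d"
    have "\<bar>f (x', y) - f (x, y)\<bar> \<le> e / 2" if "y \<in> {0..1}" for y
      using d(2)[of "(x, y)" "(x', y)"] x x' that by (auto simp: dist_Pair_Pair dist_real_def)
    then have "\<bar>horizon f x' - horizon f x\<bar> \<le> e / 2" by (intro horizon_diff_le assms x x')
    then show "dist (horizon f x') (horizon f x) < e" using e by (simp add: dist_real_def)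
  qed
qed

lemma horizon_Hoelder:
  assumes f: "f \<in> Lip_space \<alpha>" and x: "x \<in> {0..1}" "x' \<in> {0..1}"
  shows "\<bar>horizon f x - horizon f x'\<bar> \<le> Lip_norm \<alpha> f * norm (x - x') powr (3 - \<alpha>)"
proof (rule horizon_diff_le[OF Lip_space_cont[OF f] Lip_space_cont[OF f] x])
  fix y :: real assume "y \<in> {0..1}"
  then show "\<bar>f (x, y) - f (x', y)\<bar> \<le> Lip_norm \<alpha> f * norm (x - x') powr (3 - \<alpha>)"
    using Lip_space_Hoelder[OF f, of "(x, y)" "(x', y)"] x by (simp add: norm_Pair)
qed

text \<open>A function of \<open>x\<close> alone is constant on each slice, so it passes through the
  supremum; \<open>c\<close> will be \<open>t * takagi s x\<close>.\<close>

lemma horizon_add_fst: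
  assumes f: "continuous_on unit_square f" and x: "x \<in> {0..1}"
    and g: "\<And>y. y \<in> {0..1} \<Longrightarrow> g (x, y) = f (x, y) + c"
  shows "horizon g x = horizon f x + c"
proof -
  have "(SUP y\<in>{0..1}. g (x, y)) = (SUP y\<in>{0..1}. f (x, y) + c)"
    using g by (intro SUP_cong) auto
  also have "\<dots> = (SUP y\<in>{0..1}. f (x, y)) + c"
  proof (rule antisym)
    show "(SUP y\<in>{0..1}. f (x, y) + c) \<le> (SUP y\<in>{0..1}. f (x, y)) + c"
      using cSUP_upper[OF _ bdd_above_slice[OF f x]] by (intro cSUP_least) auto
    have "bdd_above ((\<lambda>y. f (x, y) + c) ` {0..1})"
    proof -
      obtain M where "\<forall>y\<in>{0..1}. f (x, y) \<le> M"
        using bdd_above_slice[OF f x] unfolding bdd_above_def by fast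
      then show ?thesis by (intro bdd_aboveI2[of _ _ "M + c"]) auto
    qed
    then have "f (x, y) + c \<le> (SUP y\<in>{0..1}. f (x, y) + c)" if "y \<in> {0..1}" for y
      using that by (intro cSUP_upper) auto
    then have "(SUP y\<in>{0..1}. f (x, y)) \<le> (SUP y\<in>{0..1}. f (x, y) + c) - c"
      by (intro cSUP_least) (auto simp: le_diff_eq)
    then show "(SUP y\<in>{0..1}. f (x, y)) + c \<le> (SUP y\<in>{0..1}. f (x, y) + c)" by simp
  qed
  finally show ?thesis using x by (simp add: horizon_def)
qed

section \<open>The probe function and the reduction to lower dimensions\<close>

text \<open>Cut off to zero outside the square to match how \<open>cont_space\<close> represents
  functions.\<close>

definition takagi_probe :: "real \<Rightarrow> real \<times> real \<Rightarrow> real" where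
  "takagi_probe s p = (if p \<in> unit_square then takagi s (fst p) else 0)"

lemma takagi_probe_in_Lip_space:
  assumes "0 \<le> s" "s \<le> 1"
  shows "takagi_probe s \<in> Lip_space (3 - s)"
proof (rule Lip_spaceI)
  have "continuous_on unit_square (\<lambda>p. takagi s (fst p))"
    by (rule continuous_on_compose2[OF continuous_on_takagi[OF assms(1), of UNIV]]) (auto intro: continuous_intros)
  then show "continuous_on unit_square (takagi_probe s)"
    by (rule continuous_on_eq) (simp add: takagi_probe_def)
  show A: "0 \<le> (\<Sum>k. 1 / (real k + 1)\<^sup>2)"
    by (intro suminf_nonneg summable_inverse_squares_Suc) simp
  fix x y :: "real \<times> real" assume xy: "x \<in> unit_square" "y \<in> unit_square" "x \<noteq> y"
  have "\<bar>takagi s (fst x) - takagi s (fst y)\<bar> \<le> (\<Sum>k. 1 / (real k + 1)\<^sup>2) * norm (x - y) powr s"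
  proof (cases "fst x = fst y")
    case False
    have "\<bar>fst x - fst y\<bar> \<le> norm (x - y)" using norm_fst_le[of "fst x - fst y" "snd x - snd y"] by (simp add: minus_prod_def)
    then have "\<bar>fst x - fst y\<bar> powr s \<le> norm (x - y) powr s" using assms by (intro powr_mono2) auto
    then show ?thesis using takagi_Hoelder[OF assms False] A
      by (meson mult_left_mono order_trans)
  qed (use A in simp)
  then show "\<bar>takagi_probe s x - takagi_probe s y\<bar> \<le> (\<Sum>k. 1 / (real k + 1)\<^sup>2) * norm (x - y) powr (3 - (3 - s))"
    using xy by (simp add: takagi_probe_def)
qed (simp add: takagi_probe_def)

text \<open>The second difference at level 0 is -1, whereas it would vanish for the zero function.
  Thus the probe spans a line.\<close>

lemma takagi_probe_nonzero:
  assumes "0 \<le> s"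
  shows "takagi_probe s \<noteq> 0"
proof
  assume zero: "takagi_probe s = 0"
  have "takagi s x = 0" if "x \<in> {0..1}" for x
  proof -
    have "takagi_probe s (x, 0) = 0" by (simp add: zero)
    then show ?thesis using that by (simp add: takagi_probe_def)
  qed
  then have "second_diff (takagi s) 0 0 = 0" by (simp add: second_diff_def)
  then show False by (simp add: second_diff_takagi[OF assms])
qed

lemma graph_on_cong: "(\<And>x. x \<in> S \<Longrightarrow> f x = g x) \<Longrightarrow> graph_on S f = graph_on S g"
  by (simp add: graph_on_def)

text \<open>Hoelder exponent \<open>3 - \<alpha>\<close> bounds the upper dimensions by
  \<open>2 + 1 - (3 - \<alpha>) = \<alpha>\<close> and
  \<open>1 + 1 - (3 - \<alpha>) = \<alpha> - 1\<close>.\<close>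

lemma has_box_dim_graph_iff:
  assumes \<alpha>: "\<alpha> \<in> {2..3}" and f: "f \<in> Lip_space \<alpha>"
  shows "has_box_dim (graph_on unit_square f) \<alpha> \<longleftrightarrow> ereal \<alpha> \<le> lower_box_dim (graph_on unit_square f)"
    and "has_box_dim (graph_on {0..1} (horizon f)) (\<alpha> - 1) \<longleftrightarrow>
      ereal (\<alpha> - 1) \<le> lower_box_dim (graph_on {0..1} (horizon f))"
proof -
  note cont = Lip_space_cont[OF f]
  have "upper_box_dim (graph_on unit_square f) \<le> ereal (DIM(real \<times> real) + 1 - (3 - \<alpha>))"
  proof (rule upper_box_dim_graph_Hoelder[OF _ _ _ _ Lip_norm_nonneg])
    show "bounded (f ` unit_square)"
      by (intro compact_imp_bounded compact_continuous_image cont compact_Times) auto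
    show "\<bar>f x - f y\<bar> \<le> Lip_norm \<alpha> f * norm (x - y) powr (3 - \<alpha>)"
      if "x \<in> unit_square" "y \<in> unit_square" "x \<noteq> y" for x y
      by (rule Lip_space_Hoelder[OF f that(1,2)])
  qed (use \<alpha> in \<open>auto simp: Basis_prod_def\<close>)
  then show "has_box_dim (graph_on unit_square f) \<alpha> \<longleftrightarrow> ereal \<alpha> \<le> lower_box_dim (graph_on unit_square f)"
    by (intro has_box_dim_iff_lower) simp
  have "upper_box_dim (graph_on {0..1} (horizon f)) \<le> ereal (DIM(real) + 1 - (3 - \<alpha>))"
  proof (rule upper_box_dim_graph_Hoelder[OF _ _ _ _ Lip_norm_nonneg])
    show "bounded (horizon f ` {0..1})"
      by (intro compact_imp_bounded compact_continuous_image continuous_on_horizon cont compact_Icc)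
    show "\<bar>horizon f x - horizon f y\<bar> \<le> Lip_norm \<alpha> f * norm (x - y) powr (3 - \<alpha>)"
      if "x \<in> {0..1}" "y \<in> {0..1}" "x \<noteq> y" for x y
      by (rule horizon_Hoelder[OF f that(1,2)])
  qed (use \<alpha> in auto)
  then show "has_box_dim (graph_on {0..1} (horizon f)) (\<alpha> - 1) \<longleftrightarrow>
      ereal (\<alpha> - 1) \<le> lower_box_dim (graph_on {0..1} (horizon f))"
    by (intro has_box_dim_iff_lower) simp
qed

section \<open>Borel sets of the Hoelder spaces\<close>

text \<open>Only finitely many mesh cubes lie near a compact graph; those it misses stay at
  positive distance.\<close>

lemma mesh_count_graph_upper_semicontinuous:
  fixes S :: "'a::euclidean_space set"
  assumes S: "compact S" "S \<noteq> {}" and f: "continuous_on S f" and \<delta>: "\<delta> > 0"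
  shows "\<exists>e>0. \<forall>g. (\<forall>x\<in>S. \<bar>f x - g x\<bar> < e) \<longrightarrow> mesh_count \<delta> (graph_on S g) \<le> mesh_count \<delta> (graph_on S f)"
proof -
  define B where "B = (\<Union>p\<in>graph_on S f. cball p 1)"
  have comp: "compact (graph_on S f)" using bounded_graph_on S(1) f by blast
  have "bounded B"
  proof -
    obtain M where M: "\<And>p. p \<in> graph_on S f \<Longrightarrow> norm p \<le> M"
      using bounded_graph_on(1)[OF S(1) f] by (auto simp: bounded_iff)
    have "norm q \<le> M + 1" if q: "q \<in> B" for q
    proof -
      obtain p where p: "p \<in> graph_on S f" "dist p q \<le> 1"
        using q unfolding B_def UN_iff mem_cball by blast
      then show ?thesis using M[OF p(1)] norm_triangle_ineq2[of q p] by (simp add: dist_norm norm_minus_commute)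
    qed
    then show ?thesis unfolding bounded_iff by blast
  qed
  then have finB: "finite (mesh_cubes \<delta> B)" using finite_mesh_cubes \<delta> by blast
  define U where "U = \<Union>(mesh_cubes \<delta> B - mesh_cubes \<delta> (graph_on S f))"
  have "closed U"
    unfolding U_def using finB by (intro closed_Union) (auto simp: mesh_cubes_def closed_mesh_cube)
  have "graph_on S f \<inter> U = {}" by (auto simp: U_def mesh_cubes_def)
  then obtain d where d: "d > 0" "\<And>p q. p \<in> graph_on S f \<Longrightarrow> q \<in> U \<Longrightarrow> d \<le> dist p q"
    using separate_compact_closed[OF comp \<open>closed U\<close>] by metis
  \<comment> \<open>The bound 1 keeps the perturbed graph inside \<open>B\<close>, near which only
    finitely many cubes occur; the bound \<open>d\<close> keeps it off the cubes in
    \<open>U\<close>.\<close>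
  show ?thesis
  proof (intro exI[of _ "min d 1"] conjI allI impI)
    fix g assume g: "\<forall>x\<in>S. \<bar>f x - g x\<bar> < min d 1"
    have "mesh_cubes \<delta> (graph_on S g) \<subseteq> mesh_cubes \<delta> (graph_on S f)"
    proof
      fix Q assume Q: "Q \<in> mesh_cubes \<delta> (graph_on S g)"
      then obtain x where x: "x \<in> S" "(x, g x) \<in> Q" by (auto simp: mesh_cubes_def graph_on_def)
      have p: "(x, f x) \<in> graph_on S f" using x(1) by (simp add: graph_on_def)
      have dist: "dist (x, f x) (x, g x) < min d 1" using bspec[OF g x(1)] by (simp add: dist_Pair_Pair dist_real_def)
      then have "(x, g x) \<in> B" unfolding B_def using p by (intro UN_I[of "(x, f x)"]) auto
      then have "Q \<in> mesh_cubes \<delta> B" using Q x by (auto simp: mesh_cubes_def)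
      moreover have "(x, g x) \<notin> U" using d(2)[OF p, of "(x, g x)"] dist by auto
      ultimately show "Q \<in> mesh_cubes \<delta> (graph_on S f)" using x(2) by (auto simp: U_def)
    qed
    then show "mesh_count \<delta> (graph_on S g) \<le> mesh_count \<delta> (graph_on S f)"
      unfolding mesh_count_eq using bounded_graph_on(1)[OF S(1) f] \<delta>
      by (intro card_mono finite_mesh_cubes) auto
  qed (use d in auto)
qed

lemma abs_diff_le_Lip_dist:
  assumes "f \<in> Lip_space \<alpha>" "g \<in> Lip_space \<alpha>"
  shows "\<bar>f p - g p\<bar> \<le> Lip_dist \<alpha> f g"
  using abs_le_Lip_norm[OF subspace_diff[OF subspace_Lip_space assms], of p] by (simp add: Lip_dist_def)

abbreviation Lip_borel :: "real \<Rightarrow> (real \<times> real \<Rightarrow> real) measure" where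
  "Lip_borel \<alpha> \<equiv> completely_metrizable_tvs.borel_algebra (Lip_topology \<alpha>)"

lemma sets_Lip_borel_openin: "openin (Lip_topology \<alpha>) U \<Longrightarrow> U \<in> sets (Lip_borel \<alpha>)"
  and space_Lip_borel: "space (Lip_borel \<alpha>) = Lip_space \<alpha>"
proof -
  interpret completely_metrizable_tvs "Lip_topology \<alpha>" by (rule completely_metrizable_tvs_Lip)
  have sub: "{U. openin (Lip_topology \<alpha>) U} \<subseteq> Pow (topspace (Lip_topology \<alpha>))" by (auto dest: openin_subset)
  show "space borel_algebra = Lip_space \<alpha>"
    unfolding borel_algebra_def using sub by (simp add: topspace_Lip_topology)
  show "openin (Lip_topology \<alpha>) U \<Longrightarrow> U \<in> sets borel_algebra"
    unfolding borel_algebra_def using sub by (simp add: sets_measure_of)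
qed

text \<open>\<open>\<Phi>\<close> stands for the identity or for \<open>horizon\<close>. Both turn a
  small \<open>Lip_dist\<close> into a small uniform distance, under which mesh counts of graphs
  cannot jump up.\<close>

lemma openin_Lip_mesh_count_less:
  fixes S :: "'a::euclidean_space set" and \<Phi> :: "(real \<times> real \<Rightarrow> real) \<Rightarrow> 'a \<Rightarrow> real"
  assumes S: "compact S" "S \<noteq> {}" and \<delta>: "\<delta> > 0"
    and cont: "\<And>f. f \<in> Lip_space \<alpha> \<Longrightarrow> continuous_on S (\<Phi> f)"
    and le: "\<And>f g x. f \<in> Lip_space \<alpha> \<Longrightarrow> g \<in> Lip_space \<alpha> \<Longrightarrow> x \<in> S \<Longrightarrow> \<bar>\<Phi> f x - \<Phi> g x\<bar> \<le> Lip_dist \<alpha> f g"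
  shows "openin (Lip_topology \<alpha>) {f \<in> Lip_space \<alpha>. real (mesh_count \<delta> (graph_on S (\<Phi> f))) < c}"
    (is "openin _ ?L")
proof -
  interpret M: Metric_space "Lip_space \<alpha>" "Lip_dist \<alpha>" by (rule Metric_space_Lip)
  have "\<exists>r>0. M.mball f r \<subseteq> ?L" if "f \<in> ?L" for f
  proof -
    from that have f: "f \<in> Lip_space \<alpha>" "real (mesh_count \<delta> (graph_on S (\<Phi> f))) < c" by simp_all
    obtain e where e: "e > 0" "\<forall>h. (\<forall>x\<in>S. \<bar>\<Phi> f x - h x\<bar> < e) \<longrightarrow>
        mesh_count \<delta> (graph_on S h) \<le> mesh_count \<delta> (graph_on S (\<Phi> f))"
      using mesh_count_graph_upper_semicontinuous[OF S cont[OF f(1)] \<delta>] by metis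
    have "g \<in> ?L" if "g \<in> M.mball f e" for g
    proof -
      have g: "g \<in> Lip_space \<alpha>" "Lip_dist \<alpha> f g < e" using that by simp_all
      have "\<forall>x\<in>S. \<bar>\<Phi> f x - \<Phi> g x\<bar> < e"
        using le_less_trans[OF le[OF f(1) g(1)] g(2)] by blast
      then have "mesh_count \<delta> (graph_on S (\<Phi> g)) \<le> mesh_count \<delta> (graph_on S (\<Phi> f))"
        using e(2) by blast
      then show ?thesis using f g by simp
    qed
    then show ?thesis using e(1) by blast
  qed
  moreover have "?L \<subseteq> Lip_space \<alpha>" by blast
  ultimately show ?thesis unfolding Lip_topology_def M.openin_mtopology by blast
qed

text \<open>The dyadic criterion writes the set with countable quantifiers over sets on which one
  mesh count is at least a constant; these are complements of open sets.\<close>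

lemma sets_Lip_borel_lower_box_dim:
  fixes S :: "'a::euclidean_space set" and \<Phi> :: "(real \<times> real \<Rightarrow> real) \<Rightarrow> 'a \<Rightarrow> real"
  assumes S: "compact S" "S \<noteq> {}"
    and cont: "\<And>f. f \<in> Lip_space \<alpha> \<Longrightarrow> continuous_on S (\<Phi> f)"
    and le: "\<And>f g x. f \<in> Lip_space \<alpha> \<Longrightarrow> g \<in> Lip_space \<alpha> \<Longrightarrow> x \<in> S \<Longrightarrow> \<bar>\<Phi> f x - \<Phi> g x\<bar> \<le> Lip_dist \<alpha> f g"
  shows "{f \<in> Lip_space \<alpha>. ereal s \<le> lower_box_dim (graph_on S (\<Phi> f))} \<in> sets (Lip_borel \<alpha>)"
proof -
  have ge: "{f \<in> Lip_space \<alpha>. c \<le> real (mesh_count \<delta> (graph_on S (\<Phi> f)))} \<in> sets (Lip_borel \<alpha>)"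
    if \<delta>: "\<delta> > 0" for c \<delta>
  proof -
    let ?L = "{f \<in> Lip_space \<alpha>. real (mesh_count \<delta> (graph_on S (\<Phi> f))) < c}"
    have "space (Lip_borel \<alpha>) - ?L \<in> sets (Lip_borel \<alpha>)"
      by (rule sets.compl_sets[OF sets_Lip_borel_openin[OF openin_Lip_mesh_count_less[OF S \<delta> cont le]]])
    moreover have "space (Lip_borel \<alpha>) - ?L = {f \<in> Lip_space \<alpha>. c \<le> real (mesh_count \<delta> (graph_on S (\<Phi> f)))}"
      unfolding space_Lip_borel by (rule set_eqI) (auto simp: not_less)
    ultimately show ?thesis by simp
  qed
  have "{f \<in> Lip_space \<alpha>. ereal s \<le> lower_box_dim (graph_on S (\<Phi> f))} =
      {f \<in> space (Lip_borel \<alpha>). \<forall>m. \<exists>N. \<forall>n. N \<le> n \<longrightarrow>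
        2 powr (real n * (s - 1 / (real m + 1))) \<le> real (mesh_count (1 / 2 ^ n) (graph_on S (\<Phi> f)))}"
  proof -
    have iff: "ereal s \<le> lower_box_dim (graph_on S (\<Phi> f)) \<longleftrightarrow> (\<forall>m. \<exists>N. \<forall>n. N \<le> n \<longrightarrow>
        2 powr (real n * (s - 1 / (real m + 1))) \<le> real (mesh_count (1 / 2 ^ n) (graph_on S (\<Phi> f))))"
      if f: "f \<in> Lip_space \<alpha>" for f
    proof -
      have "graph_on S (\<Phi> f) \<noteq> {}" using S(2) by (simp add: graph_on_def)
      from lower_box_dim_ge_iff[OF bounded_graph_on(1)[OF S(1) cont[OF f]] this, of s]
      show ?thesis unfolding eventually_sequentially .
    qed
    show ?thesis unfolding space_Lip_borel
      by (rule Collect_cong, rule conj_cong[OF refl], rule iff)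
  qed
  also have "\<dots> \<in> sets (Lip_borel \<alpha>)"
  proof (intro sets.sets_Collect_countable_All sets.sets_Collect_countable_Ex)
    fix m N n :: nat
    define c where "c = 2 powr (real n * (s - 1 / (real m + 1)))"
    define \<delta> where "\<delta> = 1 / (2 ^ n :: real)"
    have "{f \<in> space (Lip_borel \<alpha>). N \<le> n \<longrightarrow> c \<le> real (mesh_count \<delta> (graph_on S (\<Phi> f)))} \<in> sets (Lip_borel \<alpha>)"
    proof (cases "N \<le> n")
      case True
      then show ?thesis using ge[of \<delta> c] by (simp add: space_Lip_borel \<delta>_def)
    qed simp
    then show "{f \<in> space (Lip_borel \<alpha>). N \<le> n \<longrightarrow> 2 powr (real n * (s - 1 / (real m + 1))) \<le>
        real (mesh_count (1 / 2 ^ n) (graph_on S (\<Phi> f)))} \<in> sets (Lip_borel \<alpha>)"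
      unfolding c_def \<delta>_def .
  qed
  finally show ?thesis .
qed

section \<open>From almost every shift to prevalence\<close>

lemma measurable_Lip_borelI:
  assumes "h \<in> space N \<rightarrow> Lip_space \<alpha>"
    and "\<And>U. openin (Lip_topology \<alpha>) U \<Longrightarrow> h -` U \<inter> space N \<in> sets N"
  shows "h \<in> measurable N (Lip_borel \<alpha>)"
  unfolding completely_metrizable_tvs.borel_algebra_def[OF completely_metrizable_tvs_Lip] topspace_Lip_topology
proof (rule measurable_measure_of)
  show "{U. openin (Lip_topology \<alpha>) U} \<subseteq> Pow (Lip_space \<alpha>)"
    using openin_subset[of "Lip_topology \<alpha>"] by (auto simp: topspace_Lip_topology)
qed (use assms in auto)

text \<open>The complement of a translate \<open>F + x\<close> is the preimage of the complement of
  \<open>F\<close> under this map, hence Borel.\<close>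

lemma measurable_Lip_translation:
  assumes x: "x \<in> Lip_space \<alpha>"
  shows "(\<lambda>y. y - x) \<in> measurable (Lip_borel \<alpha>) (Lip_borel \<alpha>)"
proof -
  interpret completely_metrizable_tvs "Lip_topology \<alpha>" by (rule completely_metrizable_tvs_Lip)
  let ?T = "Lip_topology \<alpha>"
  have "- x \<in> topspace ?T" using x subspace_neg[OF subspace_Lip_space] by (simp add: topspace_Lip_topology)
  then have "continuous_map ?T (prod_topology ?T ?T) (\<lambda>y. (y, - x))"
    by (intro continuous_map_pairedI) auto
  from continuous_map_compose[OF this continuous_add]
  have cont: "continuous_map ?T ?T (\<lambda>y. y - x)" by (simp add: o_def)
  show ?thesis
  proof (rule measurable_Lip_borelI)
    show "(\<lambda>y. y - x) \<in> space (Lip_borel \<alpha>) \<rightarrow> Lip_space \<alpha>"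
      using subspace_diff[OF subspace_Lip_space _ x] by (auto simp: space_Lip_borel)
    fix U assume "openin ?T U"
    then have "openin ?T {y \<in> topspace ?T. y - x \<in> U}" by (rule openin_continuous_map_preimage[OF cont])
    moreover have "(\<lambda>y. y - x) -` U \<inter> space (Lip_borel \<alpha>) = {y \<in> topspace ?T. y - x \<in> U}"
      unfolding space_Lip_borel topspace_Lip_topology by blast
    ultimately show "(\<lambda>y. y - x) -` U \<inter> space (Lip_borel \<alpha>) \<in> sets (Lip_borel \<alpha>)"
      using sets_Lip_borel_openin by metis
  qed
qed

lemma measurable_Lip_line:
  assumes g: "g \<in> Lip_space \<alpha>"
  shows "(\<lambda>c. c *\<^sub>R g) \<in> measurable lborel (Lip_borel \<alpha>)"
proof -
  interpret completely_metrizable_tvs "Lip_topology \<alpha>" by (rule completely_metrizable_tvs_Lip)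
  let ?T = "Lip_topology \<alpha>"
  have "g \<in> topspace ?T" using g by (simp add: topspace_Lip_topology)
  then have "continuous_map euclideanreal (prod_topology euclideanreal ?T) (\<lambda>c. (c, g))"
    by (intro continuous_map_pairedI) auto
  from continuous_map_compose[OF this continuous_scale]
  have cont: "continuous_map euclideanreal ?T (\<lambda>c. c *\<^sub>R g)" by (simp add: o_def)
  show ?thesis
  proof (rule measurable_Lip_borelI)
    show "(\<lambda>c. c *\<^sub>R g) \<in> space lborel \<rightarrow> Lip_space \<alpha>"
      using subspace_scale[OF subspace_Lip_space g] by auto
    fix U assume "openin ?T U"
    then have "open {c. c *\<^sub>R g \<in> U}" using openin_continuous_map_preimage[OF cont] by simp
    moreover have "(\<lambda>c. c *\<^sub>R g) -` U \<inter> space lborel = {c. c *\<^sub>R g \<in> U}" by auto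
    ultimately show "(\<lambda>c. c *\<^sub>R g) -` U \<inter> space lborel \<in> sets lborel" by simp
  qed
qed

text \<open>A point \<open>c *\<^sub>R g\<close> of the probe misses \<open>F + x\<close> exactly
  when \<open>c *\<^sub>R g - x\<close> misses \<open>F\<close>, so the hypothesis is applied with
  \<open>f = - x\<close>.\<close>

lemma Lip_prevalent_1I:
  assumes F: "F \<in> sets (Lip_borel \<alpha>)" and g: "g \<in> Lip_space \<alpha>" "g \<noteq> 0"
    and AE: "\<And>f. f \<in> Lip_space \<alpha> \<Longrightarrow> AE t in lborel. f + t *\<^sub>R g \<in> F"
  shows "completely_metrizable_tvs.prevalent (Lip_topology \<alpha>) 1 F"
proof -
  interpret completely_metrizable_tvs "Lip_topology \<alpha>" by (rule completely_metrizable_tvs_Lip)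
  let ?P = "Pi\<^sub>M {..<1::nat} (\<lambda>_. lborel :: real measure)"
  have one: "{..<1::nat} = {0}" by auto
  have comp: "(\<lambda>t. t 0) \<in> measurable ?P lborel" by (rule measurable_component_singleton) simp
  interpret product_sigma_finite "\<lambda>_::nat. lborel :: real measure" by standard
  \<comment> \<open>The probe measure is built on a product with one factor; evaluation at index 0
    identifies it with Lebesgue measure on the line.\<close>
  have distr: "distr ?P lborel (\<lambda>t. t 0) = lborel" unfolding one by (rule distr_singleton)
  have line: "(\<lambda>t. \<Sum>i<1. t i *\<^sub>R g) = (\<lambda>t :: nat \<Rightarrow> real. t 0 *\<^sub>R g)" by (simp add: one)
  have meas: "(\<lambda>t. t 0 *\<^sub>R g) \<in> measurable ?P borel_algebra"
    using measurable_compose[OF comp measurable_Lip_line[OF g(1)]] .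
  have null: "topspace (Lip_topology \<alpha>) - (\<lambda>y. y + x) ` F \<in> null_sets (probe_measure 1 (\<lambda>_. g))"
    if x: "x \<in> topspace (Lip_topology \<alpha>)" for x
  proof -
    define D where "D = topspace (Lip_topology \<alpha>) - (\<lambda>y. y + x) ` F"
    have x: "x \<in> Lip_space \<alpha>" using x by (simp add: topspace_Lip_topology)
    have img: "y \<in> (\<lambda>y. y + x) ` F \<longleftrightarrow> y - x \<in> F" for y
      by (auto intro!: image_eqI[of _ _ "y - x"])
    have "D = (\<lambda>y. y - x) -` (space borel_algebra - F) \<inter> space borel_algebra"
      unfolding D_def space_Lip_borel topspace_Lip_topology set_eq_iff Diff_iff img vimage_eq Int_iff
      using subspace_diff[OF subspace_Lip_space _ x] by blast
    also have "\<dots> \<in> sets borel_algebra"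
      by (rule measurable_sets[OF measurable_Lip_translation[OF x] sets.compl_sets[OF F]])
    finally have D: "D \<in> sets borel_algebra" .
    define Z where "Z = (\<lambda>c. c *\<^sub>R g) -` D \<inter> space lborel"
    have Z: "Z \<in> sets lborel" unfolding Z_def by (rule measurable_sets[OF measurable_Lip_line[OF g(1)] D])
    have "- x \<in> Lip_space \<alpha>" by (rule subspace_neg[OF subspace_Lip_space x])
    from AE[OF this] have "AE c in lborel. c \<notin> Z"
    proof eventually_elim
      case (elim c)
      then have "c *\<^sub>R g - x \<in> F" by (simp add: add.commute)
      then show ?case unfolding Z_def D_def vimage_eq Int_iff Diff_iff img by blast
    qed
    then have "Z \<in> null_sets lborel" using AE_iff_null_sets[OF Z] by blast
    then have "(\<lambda>t. t 0) -` Z \<inter> space ?P \<in> null_sets ?P"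
      using null_sets_distr_iff[OF comp, of Z] unfolding distr by blast
    moreover have "(\<lambda>t. t 0 *\<^sub>R g) -` D \<inter> space ?P = (\<lambda>t. t 0) -` Z \<inter> space ?P"
      unfolding Z_def by auto
    ultimately show ?thesis
      unfolding probe_measure_def line D_def[symmetric] null_sets_distr_iff[OF meas] using D by simp
  qed
  have "is_basis_of 1 (\<lambda>_. g) (span {g})"
    using g(2) unfolding is_basis_of_def one by (auto simp: dependent_single)
  then have "is_probe 1 (span {g}) F"
    unfolding is_probe_def using null g(1) span_minimal[OF _ subspace_Lip_space, of "{g}"]
    by (auto simp: topspace_Lip_topology)
  then show ?thesis unfolding prevalent_def using F by blast
qed

section \<open>Prevalence\<close>

theorem theorem1p8:
  fixes \<alpha> :: real
  assumes "\<alpha> \<in> {2..3}"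
  shows "completely_metrizable_tvs.prevalent (Lip_topology \<alpha>) 1
           {f \<in> Lip_space \<alpha>. has_box_dim (graph_on unit_square f) \<alpha> \<and>
                              has_box_dim (graph_on {0..1} (horizon f)) (\<alpha> - 1)}"
    (is "completely_metrizable_tvs.prevalent _ 1 ?F")
proof -
  define s where "s = 3 - \<alpha>"
  have s: "0 \<le> s" "s \<le> 1" "3 - s = \<alpha>" "2 - s = \<alpha> - 1" using assms by (auto simp: s_def)
  have F_eq: "?F = {f \<in> Lip_space \<alpha>. ereal \<alpha> \<le> lower_box_dim (graph_on unit_square f)} \<inter>
      {f \<in> Lip_space \<alpha>. ereal (\<alpha> - 1) \<le> lower_box_dim (graph_on {0..1} (horizon f))}"
    using has_box_dim_graph_iff[OF assms] by blast
  note g = takagi_probe_in_Lip_space[OF s(1,2), unfolded s(3)]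
  show ?thesis
  proof (rule Lip_prevalent_1I[OF _ g takagi_probe_nonzero[OF s(1)]])
    have "{f \<in> Lip_space \<alpha>. ereal \<alpha> \<le> lower_box_dim (graph_on unit_square f)} \<in> sets (Lip_borel \<alpha>)"
      by (rule sets_Lip_borel_lower_box_dim)
        (simp_all add: compact_Times Lip_space_cont abs_diff_le_Lip_dist)
    moreover have "{f \<in> Lip_space \<alpha>. ereal (\<alpha> - 1) \<le> lower_box_dim (graph_on {0..1} (horizon f))}
        \<in> sets (Lip_borel \<alpha>)"
    proof (rule sets_Lip_borel_lower_box_dim)
      show "continuous_on {0..1} (horizon f)" if "f \<in> Lip_space \<alpha>" for f
        by (rule continuous_on_horizon[OF Lip_space_cont[OF that]])
      show "\<bar>horizon f x - horizon g x\<bar> \<le> Lip_dist \<alpha> f g"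
        if "f \<in> Lip_space \<alpha>" "g \<in> Lip_space \<alpha>" "x \<in> {0..1}" for f g x
        using that by (intro horizon_diff_le Lip_space_cont abs_diff_le_Lip_dist)
    qed auto
    ultimately show "?F \<in> sets (Lip_borel \<alpha>)" unfolding F_eq by (rule sets.Int)
  next
    fix f assume f: "f \<in> Lip_space \<alpha>"
    note cont = Lip_space_cont[OF f]
    have "AE t in lborel. ereal \<alpha> \<le> lower_box_dim (graph_on unit_square (\<lambda>p. f p + t * takagi s (fst p)))"
      using AE_lower_box_dim_square[OF s(1) cont] unfolding s .
    moreover have "AE t in lborel. ereal (\<alpha> - 1) \<le> lower_box_dim (graph_on {0..1} (\<lambda>x. horizon f x + t * takagi s x))"
      using AE_lower_box_dim_interval[OF s(1) continuous_on_horizon[OF cont]] unfolding s .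
    \<comment> \<open>The union of the two exceptional null sets is null, so a single probe serves
      both dimensions.\<close>
    ultimately show "AE t in lborel. f + t *\<^sub>R takagi_probe s \<in> ?F"
    proof eventually_elim
      case (elim t)
      let ?h = "f + t *\<^sub>R takagi_probe s"
      have "graph_on unit_square ?h = graph_on unit_square (\<lambda>p. f p + t * takagi s (fst p))"
        by (rule graph_on_cong) (simp add: takagi_probe_def)
      moreover have "graph_on {0..1} (horizon ?h) = graph_on {0..1} (\<lambda>x. horizon f x + t * takagi s x)"
        by (intro graph_on_cong horizon_add_fst[OF cont]) (simp_all add: takagi_probe_def)
      moreover have "?h \<in> Lip_space \<alpha>"
        by (intro subspace_add subspace_scale subspace_Lip_space f g)
      ultimately show ?case unfolding F_eq using elim by simp
    qed
  qed
qed

end
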